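(* Let $M$ be a finite Moufang loop. Then $M$ is a generalized octonion loop if and only if $M$ is nonassociative and there is a prime $p$ such that the order of $M$ is a power of $p$ and $M$ has a unique element of order $p$.
   Context: A loop is a set with a binary operation whose multiplication table is a Latin square and which has a two-sided identity $1$. A Moufang loop is a loop satisfying the (equivalent) Moufang identities, e.g. $z\cdot(x\cdot zy)=(zx\cdot z)\cdot y$ for all $x,y,z$. A Moufang $p$-loop is a finite Moufang loop whose order is a power of the prime $p$. A generalized octonion loop is a nonassociative Moufang $p$-loop (for some prime $p$) in which every abelian subloop (i.e. every associative and commutative subloop) is cyclic. *)

theory Defs
  imports "HOL-Algebra.Elementary_Groups" "HOL-Computational_Algebra.Primes"
begin

locale loop =
  fixes M (structure)
  assumes m_closed: "\<lbrakk>x \<in> carrier M; y \<in> carrier M\<rbrakk> \<Longrightarrow> x \<otimes> y \<in> carrier M"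
    and one_closed: "\<one> \<in> carrier M"
    and l_one: "x \<in> carrier M \<Longrightarrow> \<one> \<otimes> x = x"
    and r_one: "x \<in> carrier M \<Longrightarrow> x \<otimes> \<one> = x"
    and latin_row: "\<lbrakk>a \<in> carrier M; b \<in> carrier M\<rbrakk> \<Longrightarrow> \<exists>!x. x \<in> carrier M \<and> a \<otimes> x = b"
    and latin_col: "\<lbrakk>a \<in> carrier M; b \<in> carrier M\<rbrakk> \<Longrightarrow> \<exists>!y. y \<in> carrier M \<and> y \<otimes> a = b"

locale moufang_loop = loop +
  assumes moufang: "\<lbrakk>x \<in> carrier M; y \<in> carrier M; z \<in> carrier M\<rbrakk>
    \<Longrightarrow> z \<otimes> (x \<otimes> (z \<otimes> y)) = ((z \<otimes> x) \<otimes> z) \<otimes> y"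

locale moufang_p_loop = moufang_loop +
  fixes p :: nat
  assumes prime_p: "prime p"
    and finite_carrier: "finite (carrier M)"
    and order_power: "\<exists>k. order M = p ^ k"

definition associative :: "('a, 'm) monoid_scheme \<Rightarrow> bool" where
  "associative M \<longleftrightarrow> (\<forall>x\<in>carrier M. \<forall>y\<in>carrier M. \<forall>z\<in>carrier M.
     (x \<otimes>\<^bsub>M\<^esub> y) \<otimes>\<^bsub>M\<^esub> z = x \<otimes>\<^bsub>M\<^esub> (y \<otimes>\<^bsub>M\<^esub> z))"

definition commutative :: "('a, 'm) monoid_scheme \<Rightarrow> bool" where
  "commutative M \<longleftrightarrow> (\<forall>x\<in>carrier M. \<forall>y\<in>carrier M. x \<otimes>\<^bsub>M\<^esub> y = y \<otimes>\<^bsub>M\<^esub> x)"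

definition subloop :: "'a set \<Rightarrow> ('a, 'm) monoid_scheme \<Rightarrow> bool" where
  "subloop H M \<longleftrightarrow> H \<subseteq> carrier M \<and> loop (M\<lparr>carrier := H\<rparr>)"

definition abelian_subloop :: "'a set \<Rightarrow> ('a, 'm) monoid_scheme \<Rightarrow> bool" where
  "abelian_subloop H M \<longleftrightarrow>
     subloop H M \<and> associative (M\<lparr>carrier := H\<rparr>) \<and> commutative (M\<lparr>carrier := H\<rparr>)"

text \<open>
  An abelian subloop is an abelian group, so cyclicity of subloops below can be expressed by the
  library predicate \<^const>\<open>cyclic_group\<close>.
\<close>

lemma abelian_subloop_imp_comm_group:
  assumes "abelian_subloop H M"
  shows "comm_group (M\<lparr>carrier := H\<rparr>)"
proof -
  interpret L: loop "M\<lparr>carrier := H\<rparr>"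
    using assms by (simp add: abelian_subloop_def subloop_def)
  show ?thesis
  proof (rule comm_groupI)
    fix x assume x: "x \<in> carrier (M\<lparr>carrier := H\<rparr>)"
    show "\<exists>y\<in>carrier (M\<lparr>carrier := H\<rparr>).
        y \<otimes>\<^bsub>M\<lparr>carrier := H\<rparr>\<^esub> x = \<one>\<^bsub>M\<lparr>carrier := H\<rparr>\<^esub>"
      using L.latin_col[OF x L.one_closed] by blast
  qed (use assms in \<open>auto simp: abelian_subloop_def associative_def commutative_def
        intro: L.m_closed[simplified] L.one_closed[simplified] L.l_one[simplified]\<close>)
qed

definition generalized_octonion_loop :: "('a, 'm) monoid_scheme \<Rightarrow> bool" where
  "generalized_octonion_loop M \<longleftrightarrow>
     (\<exists>p. moufang_p_loop M p) \<and> \<not> associative M \<and>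
     (\<forall>H. abelian_subloop H M \<longrightarrow> cyclic_group (M\<lparr>carrier := H\<rparr>))"

text \<open>
  The library's order of an element is available for groups only. The powers below are left-normed,
  \<open>x [^] Suc n = x [^] n \<otimes> x\<close>; Moufang loops are power-associative, so the bracketing is
  irrelevant there. Elements of infinite order get the value 0.
\<close>

definition elt_order :: "('a, 'm) monoid_scheme \<Rightarrow> 'a \<Rightarrow> nat" where
  "elt_order M x =
     (if \<exists>n::nat. 0 < n \<and> x [^]\<^bsub>M\<^esub> n = \<one>\<^bsub>M\<^esub>
      then LEAST n::nat. 0 < n \<and> x [^]\<^bsub>M\<^esub> n = \<one>\<^bsub>M\<^esub> else 0)"

end

theory Submission
  imports Defs "HOL-Number_Theory.Residues"
begin

text \<open>
  Neither Moufang's theorem on diassociativity nor nilpotency of Moufang \<open>p\<close>-loops is needed: if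
  \<open>y\<close> normalizes \<open>\<langle>x\<rangle>\<close>, the Moufang identities already show that the products \<open>y\<^sup>a x\<^sup>b\<close> multiply
  as in a metacyclic group.

  Let \<open>x\<close> have maximal order and suppose \<open>\<langle>x\<rangle>\<close> is not everything. Left multiplication by \<open>x\<close>
  permutes the cosets of \<open>\<langle>x\<rangle>\<close>, and counting fixed points modulo \<open>p\<close> gives some \<open>y\<close> outside \<open>\<langle>x\<rangle>\<close>
  normalizing it. If \<open>p\<close> is odd or \<open>y\<close> centralizes \<open>x\<close>, some \<open>y\<^sup>s x\<^sup>e\<close> outside \<open>\<langle>x\<rangle>\<close> has order \<open>p\<close> and
  commutes with the elements of order \<open>p\<close> of \<open>\<langle>x\<rangle>\<close>, which yields an abelian subloop of type \<open>(p, p)\<close>.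
  So for \<open>p\<close> odd, a Moufang \<open>p\<close>-loop with cyclic abelian subloops is itself cyclic. Conversely, if
  there is a unique element of order \<open>p\<close>, the centralizing case inside an abelian subloop makes
  that subloop cyclic. For \<open>p = 2\<close>, two distinct involutions \<open>a\<close>, \<open>b\<close> both invert \<open>ab\<close> and hence commute
  with the involution in \<open>\<langle>ab\<rangle>\<close>; cyclicity of abelian subloops then identifies all three.
\<close>

section \<open>Fixed points and geometric sums modulo a prime\<close>

text \<open>Because \<open>p\<close> is prime, a point moved by \<open>g\<close> has an orbit of
  exactly \<open>p\<close> elements. These orbits partition the set \<open>F\<close> of moved
  points, so \<open>p\<close> divides \<open>card F\<close>.\<close>

lemma card_cong_card_fixpoints_prime:
  fixes g :: "'a \<Rightarrow> 'a"
  assumes p: "prime p" and fin: "finite S" and gS: "g ` S \<subseteq> S"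
    and per: "\<And>y. y \<in> S \<Longrightarrow> (g ^^ p) y = y"
  shows "[card S = card {y \<in> S. g y = y}] (mod p)"
proof -
  define F where "F = {y \<in> S. g y \<noteq> y}"
  define orb where "orb y = (\<lambda>k. (g ^^ k) y) ` (UNIV::nat set)" for y
  have p0: "p > 0" using p prime_gt_0_nat by auto
  have itS: "(g ^^ k) y \<in> S" if "y \<in> S" for k y
    using that gS by (induction k) auto
  have mult: "(g ^^ (k * d)) y = y" if "(g ^^ d) y = y" for k d y
    using that by (induction k) (auto simp: funpow_add)
  have permod: "(g ^^ k) y = (g ^^ (k mod p)) y" if "y \<in> S" for k y
  proof -
    have "(g ^^ k) y = (g ^^ (k mod p + k div p * p)) y" by simp
    also have "\<dots> = (g ^^ (k mod p)) ((g ^^ (k div p * p)) y)" by (simp only: funpow_add o_apply)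
    also have "\<dots> = (g ^^ (k mod p)) y" using mult[OF per[OF that]] by simp
    finally show ?thesis .
  qed
  have inj: "inj_on (\<lambda>k. (g ^^ k) y) {..<p}" if y: "y \<in> F" for y
  proof (rule linorder_inj_onI')
    fix i j assume ij: "i \<in> {..<p}" "j \<in> {..<p}" "i < j"
    show "(g ^^ i) y \<noteq> (g ^^ j) y"
    proof
      assume eq: "(g ^^ i) y = (g ^^ j) y"
      have yS: "y \<in> S" using y F_def by auto
      have "(g ^^ (p - i)) ((g ^^ i) y) = (g ^^ (p - i + i)) y" by (simp only: funpow_add o_apply)
      then have 1: "(g ^^ (p - i)) ((g ^^ i) y) = y" using ij per[OF yS] by simp
      have "(g ^^ (p - i)) ((g ^^ j) y) = (g ^^ (p - i + j)) y" by (simp only: funpow_add o_apply)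
      also have "p - i + j = (j - i) + p" using ij by auto
      also have "(g ^^ (j - i + p)) y = (g ^^ (j - i)) y"
        using per[OF yS] by (simp add: funpow_add)
      finally have d: "(g ^^ (j - i)) y = y" using 1 eq by simp
      \<comment> \<open>Some multiple of \<open>j - i\<close> is 1 modulo \<open>p\<close>, so a
        point fixed by \<open>g ^^ (j - i)\<close> is already fixed by \<open>g\<close>.\<close>
      have "\<not> p dvd (j - i)" using ij by (auto dest: dvd_imp_le)
      then have "coprime (j - i) p" using p prime_imp_coprime coprime_commute by blast
      then obtain a where a: "[(j - i) * a = Suc 0] (mod p)" using cong_solve_coprime_nat by blast
      have "(g ^^ (a * (j - i))) y = (g ^^ 1) y"
        using a permod[OF yS, of "a * (j - i)"] permod[OF yS, of 1]
        by (simp add: cong_def mult.commute)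
      then have "g y = y" using mult[OF d] by simp
      then show False using y F_def by auto
    qed
  qed
  have orb_eq: "orb y = (\<lambda>k. (g ^^ k) y) ` {..<p}" if y: "y \<in> S" for y
  proof (intro equalityI subsetI)
    fix w assume "w \<in> orb y"
    then obtain k where "w = (g ^^ (k mod p)) y" using permod[OF y] by (auto simp: orb_def)
    then show "w \<in> (\<lambda>k. (g ^^ k) y) ` {..<p}" using p0 by auto
  qed (auto simp: orb_def)
  have orb_card: "card (orb y) = p" if "y \<in> F" for y
    using orb_eq[of y] inj[OF that] that by (simp add: F_def card_image)
  have orb_F: "orb y \<subseteq> F" if y: "y \<in> F" for y
  proof
    fix w assume "w \<in> orb y"
    then obtain k where w: "w = (g ^^ k) y" by (auto simp: orb_def)
    have yS: "y \<in> S" "g y \<noteq> y" using y F_def by auto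
    \<comment> \<open>On \<open>S\<close> the iterate \<open>g ^^ (k * (p - 1))\<close> undoes
      \<open>g ^^ k\<close>, so a fixed point \<open>w = (g ^^ k) y\<close> would force
      \<open>g y = y\<close>.\<close>
    have inverse_iter: "(g ^^ (k * (p - 1))) ((g ^^ k) v) = v" if "v \<in> S" for v
    proof -
      have "(g ^^ (k * (p - 1))) ((g ^^ k) v) = (g ^^ (k * (p - 1) + k)) v"
        by (simp only: funpow_add o_apply)
      also have "k * (p - 1) + k = k * p" using p0 by (cases p) auto
      finally show ?thesis using mult[OF per[OF that]] by simp
    qed
    have "g w \<noteq> w"
    proof
      assume "g w = w"
      then have "(g ^^ k) (g y) = (g ^^ k) y" using w by (metis funpow_swap1)
      moreover have "g y \<in> S" using yS gS by auto
      ultimately show False using inverse_iter[of "g y"] inverse_iter[of y] yS by metis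
    qed
    then show "w \<in> F" using itS yS w by (auto simp: F_def)
  qed
  have orb_sub: "orb w \<subseteq> orb y" if wy: "w \<in> orb y" for w y
  proof -
    obtain k where w: "w = (g ^^ k) y" using wy by (auto simp: orb_def)
    have "(g ^^ n) w = (g ^^ (n + k)) y" for n by (simp add: w funpow_add)
    then show ?thesis by (auto simp: orb_def)
  qed
  have orb_sym: "y \<in> orb w" if wy: "w \<in> orb y" "y \<in> S" for w y
  proof -
    obtain k where w: "w = (g ^^ k) y" using wy by (auto simp: orb_def)
    have "(g ^^ (k * (p - 1))) w = (g ^^ (k * (p - 1) + k)) y" by (simp add: w funpow_add)
    also have "k * (p - 1) + k = k * p" using p0 by (cases p) auto
    finally have "y = (g ^^ (k * (p - 1))) w" using mult[OF per[OF wy(2)]] by simp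
    then show ?thesis by (auto simp: orb_def)
  qed
  have self: "y \<in> orb y" for y by (auto simp: orb_def intro: image_eqI[of _ _ 0])
  have UF: "\<Union> (orb ` F) = F" using orb_F self by blast
  have finF: "finite F" using fin F_def by auto
  have "p * card (orb ` F) = card (\<Union> (orb ` F))"
  proof (rule card_partition)
    fix c1 c2 assume c: "c1 \<in> orb ` F" "c2 \<in> orb ` F" "c1 \<noteq> c2"
    then obtain y1 y2 where y: "c1 = orb y1" "c2 = orb y2" "y1 \<in> F" "y2 \<in> F" by auto
    show "c1 \<inter> c2 = {}"
    proof (rule ccontr)
      assume "c1 \<inter> c2 \<noteq> {}"
      then obtain w where w: "w \<in> orb y1" "w \<in> orb y2" using y by auto
      have "y1 \<in> S" "y2 \<in> S" using y F_def by auto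
      then have "orb y1 = orb w" "orb y2 = orb w" using orb_sub orb_sym w by blast+
      then show False using c y by auto
    qed
  qed (use finF UF orb_card in auto)
  then have pF: "p dvd card F" using UF by (metis dvd_triv_left)
  have "card S = card {y \<in> S. g y = y} + card F"
  proof -
    have "S = {y \<in> S. g y = y} \<union> F" by (auto simp: F_def)
    moreover have "{y \<in> S. g y = y} \<inter> F = {}" by (auto simp: F_def)
    ultimately show ?thesis using fin finF card_Un_disjoint[of "{y \<in> S. g y = y}" F] by simp
  qed
  moreover obtain q where "card F = p * q" using pF by (elim dvdE)
  ultimately show ?thesis by (simp add: cong_def)
qed

text \<open>Induction on \<open>m\<close>: \<open>h = g ^^ (p ^ m)\<close> has period
  \<open>p\<close> on \<open>S\<close>, and \<open>g\<close> restricted to the fixed points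
  \<open>T\<close> of \<open>h\<close> has period \<open>p ^ m\<close>. Both passages preserve the
  count modulo \<open>p\<close>.\<close>

lemma card_cong_card_fixpoints:
  fixes g :: "'a \<Rightarrow> 'a"
  assumes p: "prime p" and fin: "finite S" and gS: "g ` S \<subseteq> S"
    and per: "\<And>y. y \<in> S \<Longrightarrow> (g ^^ (p ^ m)) y = y"
  shows "[card S = card {y \<in> S. g y = y}] (mod p)"
  using fin gS per
proof (induction m arbitrary: S)
  case 0
  then have "{y \<in> S. g y = y} = S" by auto
  then show ?case by simp
next
  case (Suc m)
  define h where "h = g ^^ (p ^ m)"
  define T where "T = {y \<in> S. h y = y}"
  have "h ` S \<subseteq> S"
  proof -
    have "(g ^^ k) y \<in> S" if "y \<in> S" for k y using that Suc.prems(2) by (induction k) auto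
    then show ?thesis by (auto simp: h_def)
  qed
  moreover have "(h ^^ p) y = y" if "y \<in> S" for y
    using Suc.prems(3)[OF that] by (simp add: h_def funpow_mult mult.commute)
  ultimately have 1: "[card S = card T] (mod p)"
    unfolding T_def using card_cong_card_fixpoints_prime[OF p Suc.prems(1)] by blast
  have gT: "g ` T \<subseteq> T"
    using Suc.prems(2) by (auto simp: T_def h_def funpow_swap1[symmetric])
  have 2: "[card T = card {y \<in> T. g y = y}] (mod p)"
  proof (rule Suc.IH[OF _ gT])
    show "finite T" using Suc.prems(1) by (simp add: T_def)
    show "(g ^^ (p ^ m)) y = y" if "y \<in> T" for y using that by (simp add: T_def h_def)
  qed
  have "(g ^^ k) y = y" if "g y = y" for k y using that by (induction k) auto
  then have "{y \<in> T. g y = y} = {y \<in> S. g y = y}" by (auto simp: T_def h_def)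
  then show ?case using 1 2 cong_trans by metis
qed

text \<open>With \<open>i = 1 + p * s\<close>, each \<open>i ^ t\<close> is
  \<open>1 + t * p * s\<close> modulo \<open>p * p\<close>. For odd \<open>p\<close> these terms sum
  to \<open>p\<close> modulo \<open>p * p\<close>. For \<open>p = 2\<close> and \<open>i = 3\<close>
  the sum is 4, hence the restriction.\<close>

lemma geometric_sum_prime:
  fixes p i :: nat
  assumes p: "prime p" and i: "[i = 1] (mod p)" and odd: "p \<noteq> 2 \<or> i = 1"
  obtains q where "(\<Sum>t<p. i ^ t) = p * q" "coprime q p"
proof (cases "i = 1")
  case True
  then show ?thesis using that[of 1] by simp
next
  case False
  have p2: "p > 2" using p odd False prime_ge_2_nat[of p] by auto
  have "i \<noteq> 0" using i p2 by (intro notI) (simp add: cong_def)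
  then have "p dvd i - 1" using i by (metis cong_altdef_nat less_one linorder_not_le)
  then obtain s where "i - 1 = p * s" by (elim dvdE)
  then have s: "i = 1 + p * s" using \<open>i \<noteq> 0\<close> by simp
  have pw: "[i ^ t = 1 + t * (p * s)] (mod p * p)" for t
  proof (induction t)
    case (Suc t)
    have "[i ^ Suc t = (1 + p * s) * (1 + t * (p * s))] (mod p * p)"
      unfolding power_Suc s by (intro cong_mult cong_refl) (use Suc s in simp)
    also have "(1 + p * s) * (1 + t * (p * s)) = 1 + Suc t * (p * s) + p * p * (t * s * s)"
      by (simp add: algebra_simps)
    also have "[\<dots> = 1 + Suc t * (p * s)] (mod p * p)" by (simp add: cong_def)
    finally show ?case .
  qed simp
  have "[(\<Sum>t<p. i ^ t) = (\<Sum>t<p. 1 + t * (p * s))] (mod p * p)"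
    by (rule cong_sum) (rule pw)
  also have "(\<Sum>t<p. 1 + t * (p * s)) = p + (\<Sum>t<p. t) * (p * s)"
    by (simp only: sum.distrib sum_distrib_right) simp
  also have "(\<Sum>t<p. t) = p * ((p - 1) div 2)"
  proof -
    have "odd p" using p p2 prime_odd_nat by auto
    then obtain r where "p = 2 * r + 1" by (elim oddE)
    moreover have "(\<Sum>t<2 * r + 1. t) = (2 * r + 1) * r" for r :: nat
      by (induction r) auto
    ultimately show ?thesis by simp
  qed
  also have "p + p * ((p - 1) div 2) * (p * s) = p + p * p * ((p - 1) div 2 * s)" by simp
  also have "[\<dots> = p * 1] (mod p * p)" by (simp add: cong_def)
  finally have S: "[(\<Sum>t<p. i ^ t) = p * 1] (mod p * p)" .
  then have "[(\<Sum>t<p. i ^ t) = 0] (mod p)"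
    by (metis cong_0_iff cong_dvd_iff cong_modulus_mult_nat dvd_triv_left)
  then obtain q where q: "(\<Sum>t<p. i ^ t) = p * q" by (auto simp: cong_0_iff)
  have "[q = 1] (mod p)" using S q p2 by (simp add: cong_mult_lcancel_nat cong_def)
  then show ?thesis using that[OF q] by (metis cong_imp_coprime cong_sym coprime_1_left)
qed

section \<open>Moufang identities and powers\<close>

context loop
begin

section \<open>Cancellation and finite subloops\<close>

lemma l_cancel: "\<lbrakk>a \<in> carrier M; x \<in> carrier M; y \<in> carrier M; a \<otimes> x = a \<otimes> y\<rbrakk> \<Longrightarrow> x = y"
  using latin_row m_closed by metis

lemma r_cancel: "\<lbrakk>a \<in> carrier M; x \<in> carrier M; y \<in> carrier M; x \<otimes> a = y \<otimes> a\<rbrakk> \<Longrightarrow> x = y"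
  using latin_col m_closed by metis

lemma pow_closed: "x \<in> carrier M \<Longrightarrow> x [^] (n::nat) \<in> carrier M"
  by (induction n) (auto simp: one_closed m_closed)

text \<open>A translation by an element of \<open>H\<close> is injective and maps the finite set
  \<open>H\<close> into itself, hence onto itself; this supplies the Latin square.\<close>

lemma subloop_of_finite_closed:
  assumes fin: "finite H" and sub: "H \<subseteq> carrier M" and one: "\<one> \<in> H"
    and closed: "\<And>x y. \<lbrakk>x \<in> H; y \<in> H\<rbrakk> \<Longrightarrow> x \<otimes> y \<in> H"
  shows "subloop H M"
proof -
  have row: "\<exists>!x. x \<in> H \<and> a \<otimes> x = b" if ab: "a \<in> H" "b \<in> H" for a b
  proof -
    have "inj_on ((\<otimes>) a) H" using l_cancel ab sub by (intro inj_onI) blast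
    moreover have "(\<otimes>) a ` H \<subseteq> H" using closed ab by auto
    ultimately have "(\<otimes>) a ` H = H" using fin endo_inj_surj by blast
    then have "b \<in> (\<otimes>) a ` H" using ab(2) by simp
    then obtain x where x: "x \<in> H" "a \<otimes> x = b" by (elim imageE) simp
    have "x' = x" if "x' \<in> H \<and> a \<otimes> x' = b" for x'
      by (rule l_cancel[of a]) (use that x ab sub in \<open>simp_all add: subset_iff\<close>)
    with conjI[OF x] show ?thesis by (rule ex1I)
  qed
  have col: "\<exists>!y. y \<in> H \<and> y \<otimes> a = b" if ab: "a \<in> H" "b \<in> H" for a b
  proof -
    have "inj_on (\<lambda>y. y \<otimes> a) H" using r_cancel ab sub by (intro inj_onI) blast
    moreover have "(\<lambda>y. y \<otimes> a) ` H \<subseteq> H" using closed ab by auto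
    ultimately have "(\<lambda>y. y \<otimes> a) ` H = H" using fin endo_inj_surj by blast
    then have "b \<in> (\<lambda>y. y \<otimes> a) ` H" using ab(2) by simp
    then obtain x where x: "x \<in> H" "x \<otimes> a = b" by (elim imageE) simp
    have "x' = x" if "x' \<in> H \<and> x' \<otimes> a = b" for x'
      by (rule r_cancel[of a]) (use that x ab sub in \<open>simp_all add: subset_iff\<close>)
    with conjI[OF x] show ?thesis by (rule ex1I)
  qed
  have "loop (M\<lparr>carrier := H\<rparr>)"
  proof (rule loop.intro, goal_cases)
    case (1 x y) then show ?case using closed by simp
  next
    case 2 then show ?case using one by simp
  next
    case (3 x) then show ?case using l_one sub by auto
  next
    case (4 x) then show ?case using r_one sub by auto
  next
    case (5 a b) then show ?case using row[of a b] by simp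
  next
    case (6 a b) then show ?case using col[of a b] by simp
  qed
  then show ?thesis using sub by (simp add: subloop_def)
qed

end

context moufang_loop
begin

section \<open>Inverses and the right Moufang identity\<close>

lemma flexible: "\<lbrakk>x \<in> carrier M; z \<in> carrier M\<rbrakk> \<Longrightarrow> (z \<otimes> x) \<otimes> z = z \<otimes> (x \<otimes> z)"
  using moufang[of x \<one> z] by (simp add: one_closed r_one m_closed)

text \<open>Take for \<open>w\<close> the right inverse of \<open>z\<close>. The Moufang identity
  gives \<open>z (w (z y)) = ((z w) z) y = z y\<close>, and \<open>z\<close> cancels;
  \<open>y = \<one>\<close> shows that \<open>w\<close> is also a left inverse.\<close>

lemma ex_inverse:
  assumes z: "z \<in> carrier M"
  shows "\<exists>w\<in>carrier M. z \<otimes> w = \<one> \<and> w \<otimes> z = \<one> \<and> (\<forall>y\<in>carrier M. w \<otimes> (z \<otimes> y) = y)"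
proof -
  obtain w where w: "w \<in> carrier M" "z \<otimes> w = \<one>"
    using latin_row[OF z one_closed] by blast
  have *: "w \<otimes> (z \<otimes> y) = y" if y: "y \<in> carrier M" for y
  proof (rule l_cancel[OF z _ y])
    show "w \<otimes> (z \<otimes> y) \<in> carrier M" using w z y m_closed by simp
    show "z \<otimes> (w \<otimes> (z \<otimes> y)) = z \<otimes> y" using moufang[OF w(1) y z] w(2) l_one[OF z] by simp
  qed
  show ?thesis using w * *[OF one_closed] r_one[OF z] by auto
qed

text \<open>The choice carries the left inverse property along with both inverse equations, so that
  all can be read off together; \<open>linv_unique\<close> shows that the choice is forced.\<close>

definition linv :: "'a \<Rightarrow> 'a" where
  "linv z = (SOME w. w \<in> carrier M \<and> z \<otimes> w = \<one> \<and> w \<otimes> z = \<one> \<and> (\<forall>y\<in>carrier M. w \<otimes> (z \<otimes> y) = y))"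

lemma
  assumes z: "z \<in> carrier M"
  shows linv_closed: "linv z \<in> carrier M"
    and r_linv: "z \<otimes> linv z = \<one>"
    and l_linv: "linv z \<otimes> z = \<one>"
    and left_inverse_property: "y \<in> carrier M \<Longrightarrow> linv z \<otimes> (z \<otimes> y) = y"
proof -
  have "\<exists>w. w \<in> carrier M \<and> z \<otimes> w = \<one> \<and> w \<otimes> z = \<one> \<and> (\<forall>y\<in>carrier M. w \<otimes> (z \<otimes> y) = y)"
    using ex_inverse[OF z] by blast
  from someI_ex[OF this]
  show "linv z \<in> carrier M" "z \<otimes> linv z = \<one>" "linv z \<otimes> z = \<one>"
    "y \<in> carrier M \<Longrightarrow> linv z \<otimes> (z \<otimes> y) = y"
    unfolding linv_def by blast+
qed

lemma linv_unique:
  assumes "x \<in> carrier M" "w \<in> carrier M" "x \<otimes> w = \<one>"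
  shows "linv x = w"
  by (rule l_cancel[of x]) (simp_all add: assms linv_closed r_linv)

lemma linv_linv: "x \<in> carrier M \<Longrightarrow> linv (linv x) = x"
  by (rule linv_unique) (simp_all add: linv_closed l_linv)

text \<open>With \<open>w = (z x) z\<close>, the Moufang identity gives
  \<open>w (z^-1 x^-1) = z\<close> and \<open>w^-1 = (z^-1 x^-1) z^-1\<close>. Hence
  \<open>((z^-1 x^-1) z^-1) z = z^-1 x^-1\<close>, and every \<open>u\<close> has the form
  \<open>z^-1 x^-1\<close>.\<close>

lemma right_inverse_property:
  assumes u: "u \<in> carrier M" and z: "z \<in> carrier M"
  shows "(u \<otimes> linv z) \<otimes> z = u"
proof -
  define x where "x = linv (z \<otimes> u)"
  have x: "x \<in> carrier M" "linv x = z \<otimes> u"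
    using u z by (simp_all add: x_def linv_closed linv_linv m_closed)
  have zi: "linv z \<in> carrier M" by (rule linv_closed[OF z])
  have u_eq: "linv z \<otimes> linv x = u" using x left_inverse_property[OF z u] by simp
  let ?w = "(z \<otimes> x) \<otimes> z"
  have w: "?w \<in> carrier M" using x z by (simp add: m_closed)
  have zz: "z \<otimes> (linv z \<otimes> y) = y" if "y \<in> carrier M" for y
    using left_inverse_property[OF zi that] linv_linv[OF z] by simp
  have xx: "x \<otimes> (linv x \<otimes> y) = y" if "y \<in> carrier M" for y
    using left_inverse_property[OF linv_closed[OF x(1)] that] linv_linv[OF x(1)] by simp
  have "?w \<otimes> ((linv z \<otimes> linv x) \<otimes> linv z) = ?w \<otimes> (linv z \<otimes> (linv x \<otimes> linv z))"
    using flexible[OF linv_closed[OF x(1)] zi] by simp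
  also have "\<dots> = z \<otimes> (x \<otimes> (z \<otimes> (linv z \<otimes> (linv x \<otimes> linv z))))"
    using moufang[OF x(1) _ z, of "linv z \<otimes> (linv x \<otimes> linv z)"] x(1) z by (simp add: linv_closed m_closed)
  also have "\<dots> = \<one>" using x(1) z by (simp add: zz xx linv_closed m_closed r_linv)
  finally have "linv ?w = (linv z \<otimes> linv x) \<otimes> linv z"
    using w x(1) z by (intro linv_unique) (simp_all add: linv_closed m_closed)
  moreover have "?w \<otimes> (linv z \<otimes> linv x) = z"
    using moufang[OF x(1) _ z, of "linv z \<otimes> linv x"] x(1) z
    by (simp add: linv_closed m_closed zz r_linv r_one)
  then have "linv ?w \<otimes> z = linv z \<otimes> linv x"
    using left_inverse_property[OF w, of "linv z \<otimes> linv x"] x(1) z by (simp add: linv_closed m_closed)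
  ultimately show ?thesis using u_eq by simp
qed

text \<open>From \<open>(x y) y^-1 = x\<close> follows \<open>(x y)^-1 x = y^-1\<close>; right
  multiplication by \<open>x^-1\<close> finishes.\<close>

lemma linv_mult:
  assumes x: "x \<in> carrier M" and y: "y \<in> carrier M"
  shows "linv (x \<otimes> y) = linv y \<otimes> linv x"
proof -
  have xy: "x \<otimes> y \<in> carrier M" using x y by (rule m_closed)
  have "(x \<otimes> y) \<otimes> linv y = x"
    using right_inverse_property[OF x linv_closed[OF y]] linv_linv[OF y] by simp
  then have *: "linv (x \<otimes> y) \<otimes> x = linv y"
    using left_inverse_property[OF xy linv_closed[OF y]] by simp
  have "(linv (x \<otimes> y) \<otimes> x) \<otimes> linv x = linv (x \<otimes> y)"
    using right_inverse_property[OF linv_closed[OF xy] linv_closed[OF x]] linv_linv[OF x] by simp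
  then show ?thesis using * by simp
qed

text \<open>Inversion reverses products, so it carries the left Moufang identity at the inverses to
  its mirror image.\<close>

lemma right_moufang:
  assumes x: "x \<in> carrier M" and y: "y \<in> carrier M" and z: "z \<in> carrier M"
  shows "((y \<otimes> z) \<otimes> x) \<otimes> z = y \<otimes> (z \<otimes> (x \<otimes> z))"
proof -
  let ?x = "linv x" and ?y = "linv y" and ?z = "linv z"
  have c: "?x \<in> carrier M" "?y \<in> carrier M" "?z \<in> carrier M" using x y z by (auto intro: linv_closed)
  have "linv (?z \<otimes> (?x \<otimes> (?z \<otimes> ?y))) = linv (((?z \<otimes> ?x) \<otimes> ?z) \<otimes> ?y)"
    using moufang[of ?x ?y ?z] c by simp
  then show ?thesis using x y z c by (simp add: linv_mult m_closed linv_linv)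
qed

section \<open>Powers as iterated translations\<close>

lemma pow_Suc_left:
  assumes x: "x \<in> carrier M"
  shows "x \<otimes> x [^] (n::nat) = x [^] Suc n"
proof (induction n)
  case (Suc n)
  have "x \<otimes> x [^] Suc n = x \<otimes> (x [^] n \<otimes> x)" by simp
  also have "\<dots> = (x \<otimes> x [^] n) \<otimes> x" using flexible[OF pow_closed[OF x] x] by simp
  finally show ?case using Suc by simp
qed (simp add: x l_one r_one)

text \<open>Since \<open>x^(k+2) = (x x^k) x\<close>, the Moufang identity splits left
  multiplication by \<open>x^(k+2)\<close> into those by \<open>x\<close>, \<open>x^k\<close> and
  \<open>x\<close>. The induction thus goes in steps of two, with a hypothesis for all
  \<open>y\<close>, as it is applied at \<open>x y\<close>.\<close>

lemma pow_left_mult: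
  assumes x: "x \<in> carrier M" and y: "y \<in> carrier M"
  shows "x [^] (n::nat) \<otimes> y = (((\<otimes>) x) ^^ n) y"
proof -
  have "\<forall>y\<in>carrier M. x [^] n \<otimes> y = (((\<otimes>) x) ^^ n) y"
  proof (induction n rule: nat_less_induct)
    case (1 n)
    consider "n = 0" | "n = 1" | k where "n = Suc (Suc k)" by (cases n; cases "n - 1") auto
    then show ?case
    proof cases
      case 3
      have "x [^] n \<otimes> y = (((\<otimes>) x) ^^ n) y" if y: "y \<in> carrier M" for y
      proof -
        have "x [^] n \<otimes> y = ((x \<otimes> x [^] k) \<otimes> x) \<otimes> y"
          using pow_Suc_left[OF x, of k] 3 by simp
        also have "\<dots> = x \<otimes> (x [^] k \<otimes> (x \<otimes> y))" using moufang[OF pow_closed[OF x] y x] by simp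
        also have "\<dots> = x \<otimes> (((\<otimes>) x) ^^ k) (x \<otimes> y)" using 1 3 x y m_closed by simp
        also have "\<dots> = (((\<otimes>) x) ^^ n) y" using 3 by (simp add: funpow_swap1)
        finally show ?thesis .
      qed
      then show ?thesis by blast
    qed (simp_all add: x l_one)
  qed
  then show ?thesis using y by blast
qed

text \<open>Mirror image of \<open>pow_left_mult\<close>, from the right Moufang identity.\<close>

lemma pow_right_mult:
  assumes x: "x \<in> carrier M" and y: "y \<in> carrier M"
  shows "y \<otimes> x [^] (n::nat) = ((\<lambda>w. w \<otimes> x) ^^ n) y"
proof -
  have "\<forall>y\<in>carrier M. y \<otimes> x [^] n = ((\<lambda>w. w \<otimes> x) ^^ n) y"
  proof (induction n rule: nat_less_induct)
    case (1 n)
    consider "n = 0" | "n = 1" | k where "n = Suc (Suc k)" by (cases n; cases "n - 1") auto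
    then show ?case
    proof cases
      case 3
      have "y \<otimes> x [^] n = ((\<lambda>w. w \<otimes> x) ^^ n) y" if y: "y \<in> carrier M" for y
      proof -
        have "y \<otimes> x [^] n = y \<otimes> (x \<otimes> (x [^] k \<otimes> x))"
          using pow_Suc_left[OF x, of "Suc k"] 3 by simp
        also have "\<dots> = ((y \<otimes> x) \<otimes> x [^] k) \<otimes> x" using right_moufang[OF pow_closed[OF x] y x] by simp
        also have "\<dots> = ((\<lambda>w. w \<otimes> x) ^^ k) (y \<otimes> x) \<otimes> x" using 1 3 x y m_closed by simp
        also have "\<dots> = ((\<lambda>w. w \<otimes> x) ^^ n) y"
          using 3 funpow_swap1[of "\<lambda>w. w \<otimes> x" k y] by simp
        finally show ?thesis .
      qed
      then show ?thesis by blast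
    qed (simp_all add: x l_one r_one)
  qed
  then show ?thesis using y by blast
qed

lemma pow_add_left:
  assumes x: "x \<in> carrier M" and y: "y \<in> carrier M"
  shows "x [^] (m::nat) \<otimes> (x [^] (n::nat) \<otimes> y) = x [^] (m + n) \<otimes> y"
  using pow_left_mult[OF x m_closed[OF pow_closed[OF x, of n] y], of m]
    pow_left_mult[OF x y, of n] pow_left_mult[OF x y, of "m + n"] by (simp add: funpow_add)

lemma pow_add_right:
  assumes x: "x \<in> carrier M" and y: "y \<in> carrier M"
  shows "(y \<otimes> x [^] (m::nat)) \<otimes> x [^] (n::nat) = y \<otimes> x [^] (m + n)"
  using pow_right_mult[OF x m_closed[OF y pow_closed[OF x, of m]], of n]
    pow_right_mult[OF x y, of m] pow_right_mult[OF x y, of "n + m"]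
  by (simp add: funpow_add add.commute[of m n])

lemma pow_mult_pow: "x \<in> carrier M \<Longrightarrow> x [^] (m::nat) \<otimes> x [^] (n::nat) = x [^] (m + n)"
  using pow_add_left[of x \<one> m n] by (simp add: one_closed r_one pow_closed)

lemma one_pow: "\<one> [^] (n::nat) = \<one>"
  by (induction n) (simp_all add: l_one one_closed)

lemma pow_pow: "x \<in> carrier M \<Longrightarrow> (x [^] (m::nat)) [^] (n::nat) = x [^] (m * n)"
  by (induction n) (simp_all add: pow_mult_pow add.commute)

lemma pow_Suc_0: "x \<in> carrier M \<Longrightarrow> x [^] Suc 0 = x"
  by (simp add: l_one)

section \<open>Flexibility for powers and metacyclic products\<close>

lemma flexible_pow_right:
  assumes x: "x \<in> carrier M" and y: "y \<in> carrier M"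
  shows "x \<otimes> (y \<otimes> x [^] (n::nat)) = (x \<otimes> y) \<otimes> x [^] n"
proof (induction n)
  case (Suc n)
  have yn: "y \<otimes> x [^] n \<in> carrier M" using x y by (simp add: m_closed pow_closed)
  have step: "w \<otimes> x [^] Suc n = (w \<otimes> x [^] n) \<otimes> x" if "w \<in> carrier M" for w
    using pow_add_right[OF x that, of n 1] x by (simp add: l_one)
  have "x \<otimes> (y \<otimes> x [^] Suc n) = (x \<otimes> (y \<otimes> x [^] n)) \<otimes> x"
    using flexible[OF yn x] step[OF y] by simp
  then show ?case using Suc step[OF m_closed[OF x y]] by simp
qed (simp add: x y m_closed r_one)

lemma flexible_pow:
  assumes x: "x \<in> carrier M" and y: "y \<in> carrier M"
  shows "x [^] (m::nat) \<otimes> (y \<otimes> x [^] (n::nat)) = (x [^] m \<otimes> y) \<otimes> x [^] n"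
proof (induction m)
  case (Suc m)
  have step: "x [^] Suc m \<otimes> w = x \<otimes> (x [^] m \<otimes> w)" if "w \<in> carrier M" for w
    using pow_add_left[OF x that, of 1 m] x by (simp add: l_one)
  show ?case using x y Suc
    by (simp only: step m_closed pow_closed flexible_pow_right)
qed (simp add: x y m_closed l_one pow_closed)

text \<open>The relation says that \<open>y\<close> conjugates \<open>x\<close> to
  \<open>x^i\<close>; flexibility supplies the rebracketing that associativity would give.\<close>

lemma pow_swap:
  assumes x: "x \<in> carrier M" and y: "y \<in> carrier M" and rel: "x \<otimes> y = y \<otimes> x [^] (i::nat)"
  shows "x [^] (b::nat) \<otimes> y = y \<otimes> x [^] (i * b)"
proof (induction b)
  case (Suc b)
  have "x [^] Suc b \<otimes> y = x \<otimes> (x [^] b \<otimes> y)"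
    using pow_add_left[OF x y, of 1 b] x by (simp add: l_one)
  also have "\<dots> = (y \<otimes> x [^] i) \<otimes> x [^] (i * b)"
    using Suc flexible_pow_right[OF x y] rel by simp
  also have "\<dots> = y \<otimes> x [^] (i * Suc b)" using pow_add_right[OF x y] by simp
  finally show ?case .
qed (simp add: x y l_one r_one)

text \<open>Each passage across a factor \<open>y\<close> multiplies the exponent of
  \<open>x\<close> by \<open>i\<close>.\<close>

lemma pow_swap_pow:
  assumes x: "x \<in> carrier M" and y: "y \<in> carrier M" and rel: "x \<otimes> y = y \<otimes> x [^] (i::nat)"
  shows "x [^] (b::nat) \<otimes> y [^] (c::nat) = y [^] c \<otimes> x [^] (i ^ c * b)"
proof (induction c)
  case (Suc c)
  have "x [^] b \<otimes> y [^] Suc c = (x [^] b \<otimes> y [^] c) \<otimes> y"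
    using pow_add_right[OF y pow_closed[OF x], of b c 1] y by (simp add: l_one)
  also have "\<dots> = (y [^] c \<otimes> x [^] (i ^ c * b)) \<otimes> y" using Suc by simp
  also have "\<dots> = y [^] c \<otimes> (x [^] (i ^ c * b) \<otimes> y)"
    using flexible_pow[OF y pow_closed[OF x], of c "i ^ c * b" 1] y by (simp add: l_one)
  also have "\<dots> = y [^] c \<otimes> (y \<otimes> x [^] (i * (i ^ c * b)))" using pow_swap[OF x y rel] by simp
  also have "\<dots> = y [^] Suc c \<otimes> x [^] (i ^ Suc c * b)"
    using pow_add_left[OF y pow_closed[OF x], of c 1 "i * (i ^ c * b)"] y by (simp add: l_one mult.assoc)
  finally show ?case .
qed (simp add: x l_one r_one pow_closed)

text \<open>
  Right Moufang with \<open>z = x\<^sup>b\<close> turns the left factor \<open>y\<^sup>a x\<^sup>b\<close> into the pure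
  power \<open>y\<^sup>a\<close>. This replaces diassociativity.
\<close>

lemma metacyclic_mult:
  assumes x: "x \<in> carrier M" and y: "y \<in> carrier M" and rel: "x \<otimes> y = y \<otimes> x [^] (i::nat)"
  shows "(y [^] (a::nat) \<otimes> x [^] (b::nat)) \<otimes> (y [^] (c::nat) \<otimes> x [^] (d::nat))
    = y [^] (a + c) \<otimes> x [^] (i ^ c * b + d)"
proof (rule r_cancel[of "x [^] b"])
  have cl: "\<And>n::nat. x [^] n \<in> carrier M" "\<And>n::nat. y [^] n \<in> carrier M"
    using x y by (auto intro: pow_closed)
  have 1: "(y [^] c \<otimes> x [^] d) \<otimes> x [^] b = y [^] c \<otimes> x [^] (d + b)"
    using pow_add_right[OF x cl(2)] by simp
  have 2: "x [^] b \<otimes> (y [^] c \<otimes> x [^] (d + b)) = (y [^] c \<otimes> x [^] (i ^ c * b)) \<otimes> x [^] (d + b)"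
    using flexible_pow[OF x cl(2), of b c "d + b"] pow_swap_pow[OF x y rel] by simp
  have "((y [^] a \<otimes> x [^] b) \<otimes> (y [^] c \<otimes> x [^] d)) \<otimes> x [^] b
    = y [^] a \<otimes> (x [^] b \<otimes> ((y [^] c \<otimes> x [^] d) \<otimes> x [^] b))"
    using right_moufang cl m_closed by simp
  also have "\<dots> = y [^] a \<otimes> (y [^] c \<otimes> x [^] (i ^ c * b + (d + b)))"
    using 1 2 pow_add_right[OF x cl(2)] by simp
  also have "\<dots> = y [^] (a + c) \<otimes> x [^] (i ^ c * b + (d + b))"
    using pow_add_left[OF y cl(1)] by simp
  also have "\<dots> = (y [^] (a + c) \<otimes> x [^] (i ^ c * b + d)) \<otimes> x [^] b"
    using pow_add_right[OF x cl(2)] by (simp add: add.assoc)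
  finally show "((y [^] a \<otimes> x [^] b) \<otimes> (y [^] c \<otimes> x [^] d)) \<otimes> x [^] b
    = (y [^] (a + c) \<otimes> x [^] (i ^ c * b + d)) \<otimes> x [^] b" .
qed (auto intro!: m_closed pow_closed x y)

text \<open>One more factor \<open>y x^e\<close> moves the collected power of \<open>x\<close>
  across \<open>y\<close>. The coefficients of \<open>e\<close> thus obey
  \<open>S(m+1) = i S(m) + 1\<close>, the recursion of the geometric sum.\<close>

lemma metacyclic_pow:
  assumes x: "x \<in> carrier M" and y: "y \<in> carrier M" and rel: "x \<otimes> y = y \<otimes> x [^] (i::nat)"
  shows "(y \<otimes> x [^] (e::nat)) [^] (m::nat) = y [^] m \<otimes> x [^] (e * (\<Sum>t<m. i ^ t))"
proof (induction m)
  case (Suc m)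
  have S: "(\<Sum>t<Suc m. i ^ t) = i * (\<Sum>t<m. i ^ t) + 1"
    by (simp add: sum.lessThan_Suc_shift sum_distrib_left del: sum.lessThan_Suc)
  have "(y \<otimes> x [^] e) [^] Suc m = (y [^] m \<otimes> x [^] (e * (\<Sum>t<m. i ^ t))) \<otimes> (y [^] Suc 0 \<otimes> x [^] e)"
    using Suc y by (simp add: l_one)
  also have "\<dots> = y [^] Suc m \<otimes> x [^] (e * (\<Sum>t<Suc m. i ^ t))"
    unfolding metacyclic_mult[OF x y rel] S by (simp add: algebra_simps)
  finally show ?case .
qed (simp add: one_closed l_one)

end

section \<open>Orders and cosets in Moufang p-loops\<close>

text \<open>In a finite Moufang loop the natural powers already include the inverse of
  \<open>x\<close>, so this is the cyclic subloop generated by \<open>x\<close>.\<close>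

definition cyclic_powers :: "('a, 'm) monoid_scheme \<Rightarrow> 'a \<Rightarrow> 'a set" where
  "cyclic_powers M x = range (\<lambda>n::nat. x [^]\<^bsub>M\<^esub> n)"

context moufang_p_loop
begin

lemma p_gt_1: "1 < p"
  using prime_p by (rule prime_gt_1_nat)

lemma ex_pow_eq_one:
  assumes x: "x \<in> carrier M"
  shows "\<exists>n::nat. 0 < n \<and> x [^] n = \<one>"
proof -
  have "range (\<lambda>n::nat. x [^] n) \<subseteq> carrier M" using pow_closed[OF x] by auto
  then have "finite (range (\<lambda>n::nat. x [^] n))" using finite_carrier finite_subset by blast
  then have "\<not> inj (\<lambda>n::nat. x [^] n)" using finite_imageD by fastforce
  then obtain i j :: nat where ij: "i < j" "x [^] i = x [^] j"
    by (metis linorder_injI)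
  have "x [^] i \<otimes> x [^] (j - i) = x [^] j"
    using ij(1) pow_mult_pow[OF x, of i "j - i"] by simp
  then have "x [^] i \<otimes> x [^] (j - i) = x [^] i \<otimes> \<one>"
    using ij(2) r_one[OF pow_closed[OF x, of i]] by simp
  then have "x [^] (j - i) = \<one>"
    by (rule l_cancel[OF pow_closed[OF x] pow_closed[OF x] one_closed])
  then show ?thesis using ij by (intro exI[of _ "j - i"]) simp
qed

lemma
  assumes x: "x \<in> carrier M"
  shows elt_order_pos: "0 < elt_order M x"
    and pow_elt_order: "x [^] elt_order M x = \<one>"
    and elt_order_le: "\<lbrakk>0 < n; x [^] n = \<one>\<rbrakk> \<Longrightarrow> elt_order M x \<le> n"
proof -
  have *: "elt_order M x = (LEAST n::nat. 0 < n \<and> x [^] n = \<one>)"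
    using ex_pow_eq_one[OF x] by (simp add: elt_order_def)
  show "0 < elt_order M x" "x [^] elt_order M x = \<one>"
    unfolding * using LeastI_ex[OF ex_pow_eq_one[OF x]] by blast+
  show "\<lbrakk>0 < n; x [^] n = \<one>\<rbrakk> \<Longrightarrow> elt_order M x \<le> n"
    unfolding * by (intro Least_le conjI)
qed

lemma pow_mod_elt_order:
  assumes x: "x \<in> carrier M"
  shows "x [^] (n mod elt_order M x) = x [^] n"
proof -
  let ?o = "elt_order M x"
  have "x [^] (?o * (n div ?o)) = \<one>"
    using pow_pow[OF x, of ?o "n div ?o"] pow_elt_order[OF x] by (simp add: one_pow)
  moreover have "x [^] (?o * (n div ?o)) \<otimes> x [^] (n mod ?o) = x [^] n"
    using pow_mult_pow[OF x, of "?o * (n div ?o)" "n mod ?o"] by simp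
  ultimately show ?thesis using pow_closed[OF x] by (simp add: l_one)
qed

lemma pow_eq_one_iff:
  assumes x: "x \<in> carrier M"
  shows "x [^] n = \<one> \<longleftrightarrow> elt_order M x dvd n"
proof
  assume "x [^] n = \<one>"
  then have "x [^] (n mod elt_order M x) = \<one>" using pow_mod_elt_order[OF x] by simp
  moreover have "n mod elt_order M x < elt_order M x" using elt_order_pos[OF x] by simp
  ultimately show "elt_order M x dvd n" using elt_order_le[OF x, of "n mod elt_order M x"]
    by (metis dvd_eq_mod_eq_0 gr0I not_less)
next
  assume "elt_order M x dvd n"
  then show "x [^] n = \<one>" using pow_mod_elt_order[OF x, of n] by simp
qed

lemma pow_eq_pow_iff:
  assumes x: "x \<in> carrier M"
  shows "x [^] a = x [^] b \<longleftrightarrow> [a = b] (mod elt_order M x)"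
proof (induction a b rule: linorder_wlog)
  case (le a b)
  have "x [^] a \<otimes> x [^] (b - a) = x [^] b" using le pow_mult_pow[OF x, of a "b - a"] by simp
  moreover have "x [^] a \<otimes> \<one> = x [^] a" by (rule r_one[OF pow_closed[OF x]])
  ultimately have "x [^] a = x [^] b \<longleftrightarrow> x [^] (b - a) = \<one>"
    using l_cancel[OF pow_closed[OF x] pow_closed[OF x] one_closed] by metis
  also have "\<dots> \<longleftrightarrow> [b = a] (mod elt_order M x)"
    unfolding pow_eq_one_iff[OF x] using cong_altdef_nat[OF le] by blast
  also have "\<dots> \<longleftrightarrow> [a = b] (mod elt_order M x)" by (rule cong_sym_eq)
  finally show ?case .
next
  case (sym a b)
  then show ?case unfolding cong_sym_eq[of a b] eq_commute[of "x [^] a" "x [^] b"] .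
qed

lemma elt_order_eq_prime_iff:
  assumes x: "x \<in> carrier M"
  shows "elt_order M x = p \<longleftrightarrow> x \<noteq> \<one> \<and> x [^] p = \<one>"
proof -
  have "x = \<one> \<longleftrightarrow> elt_order M x dvd 1"
    using pow_eq_one_iff[OF x, of 1] x by (simp add: l_one)
  moreover have "x [^] p = \<one> \<longleftrightarrow> elt_order M x = 1 \<or> elt_order M x = p"
    unfolding pow_eq_one_iff[OF x] using prime_p by (metis dvd_refl one_dvd prime_nat_iff)
  ultimately show ?thesis using p_gt_1 by auto
qed

section \<open>Cyclic subloops and their cosets\<close>

lemma pow_in_cyclic_powers: "x [^] (n::nat) \<in> cyclic_powers M x"
  by (simp add: cyclic_powers_def)

lemma self_in_cyclic_powers: "x \<in> carrier M \<Longrightarrow> x \<in> cyclic_powers M x"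
  using pow_in_cyclic_powers[of x 1] by (simp add: l_one)

lemma one_in_cyclic_powers: "\<one> \<in> cyclic_powers M x"
  using pow_in_cyclic_powers[of x 0] by simp

lemma cyclic_powers_subset: "x \<in> carrier M \<Longrightarrow> cyclic_powers M x \<subseteq> carrier M"
  by (auto simp: cyclic_powers_def pow_closed)

lemma cyclic_powers_mono:
  assumes x: "x \<in> carrier M" and z: "z \<in> cyclic_powers M x"
  shows "cyclic_powers M z \<subseteq> cyclic_powers M x"
  using z by (auto simp: cyclic_powers_def pow_pow[OF x])

lemma card_cyclic_powers:
  assumes x: "x \<in> carrier M"
  shows "card (cyclic_powers M x) = elt_order M x"
proof -
  have "cyclic_powers M x = (\<lambda>n. x [^] n) ` {..<elt_order M x}"
  proof (intro equalityI subsetI)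
    fix w assume "w \<in> cyclic_powers M x"
    then obtain n :: nat where "w = x [^] n" by (auto simp: cyclic_powers_def)
    then have "w = x [^] (n mod elt_order M x)" using pow_mod_elt_order[OF x] by simp
    then show "w \<in> (\<lambda>n. x [^] n) ` {..<elt_order M x}" using elt_order_pos[OF x] by simp
  qed (auto simp: cyclic_powers_def)
  moreover have "inj_on (\<lambda>n. x [^] n) {..<elt_order M x}"
    by (intro inj_onI) (simp add: pow_eq_pow_iff[OF x] cong_less_modulus_unique_nat)
  ultimately show ?thesis by (simp add: card_image)
qed

lemma card_coset:
  assumes x: "x \<in> carrier M" and y: "y \<in> carrier M"
  shows "card ((\<otimes>) y ` cyclic_powers M x) = elt_order M x"
proof -
  have "inj_on ((\<otimes>) y) (cyclic_powers M x)"
  proof (rule inj_onI)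
    fix a b assume "a \<in> cyclic_powers M x" "b \<in> cyclic_powers M x" "y \<otimes> a = y \<otimes> b"
    then show "a = b" using cyclic_powers_subset[OF x] y l_cancel[of y a b] by auto
  qed
  then show ?thesis by (simp add: card_image card_cyclic_powers[OF x])
qed

text \<open>With \<open>o\<close> the order of \<open>x\<close>, the exponent
  \<open>k * (o - 1)\<close> stands for \<open>-k\<close>: its sum with \<open>k\<close> is a
  multiple of \<open>o\<close>.\<close>

lemma coset_undo:
  assumes x: "x \<in> carrier M" and y: "y \<in> carrier M"
  shows "(y \<otimes> x [^] k) \<otimes> x [^] (k * (elt_order M x - 1)) = y"
proof -
  have "k + k * (elt_order M x - 1) = k * elt_order M x"
    using elt_order_pos[OF x] by (cases "elt_order M x") auto
  moreover have "x [^] (k * elt_order M x) = \<one>" using pow_eq_one_iff[OF x] by simp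
  ultimately show ?thesis using pow_add_right[OF x y] y by (simp add: r_one)
qed

text \<open>Cosets of a subloop may overlap in general loops. Here
  \<open>(v x^l) x^n = v x^(l+n)\<close> gives one inclusion, and \<open>coset_undo\<close> reverses
  the roles for the other.\<close>

lemma coset_eqI:
  assumes x: "x \<in> carrier M" and y: "y \<in> carrier M" and w: "w \<in> (\<otimes>) y ` cyclic_powers M x"
  shows "(\<otimes>) w ` cyclic_powers M x = (\<otimes>) y ` cyclic_powers M x"
proof -
  obtain k :: nat where k: "w = y \<otimes> x [^] k" using w by (auto simp: cyclic_powers_def)
  have sub: "(\<otimes>) v' ` cyclic_powers M x \<subseteq> (\<otimes>) v ` cyclic_powers M x"
    if "v' = v \<otimes> x [^] l" "v \<in> carrier M" for v v' and l :: nat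
    using that pow_add_right[OF x] by (auto simp: cyclic_powers_def)
  have "y = w \<otimes> x [^] (k * (elt_order M x - 1))" using coset_undo[OF x y] k by simp
  moreover have "w \<in> carrier M" using k x y by (simp add: m_closed pow_closed)
  ultimately show ?thesis using sub[OF k y] sub by blast
qed

lemma self_in_coset: "y \<in> carrier M \<Longrightarrow> y \<in> (\<otimes>) y ` cyclic_powers M x"
  using one_in_cyclic_powers by (force simp: r_one)

text \<open>Lagrange's theorem for cyclic subloops: by \<open>coset_eqI\<close> the cosets partition
  the carrier, and all have the same size.\<close>

lemma order_eq_mult_cosets:
  assumes x: "x \<in> carrier M"
  shows "order M = elt_order M x * card ((\<lambda>y. (\<otimes>) y ` cyclic_powers M x) ` carrier M)"
proof -
  let ?C = "(\<lambda>y. (\<otimes>) y ` cyclic_powers M x) ` carrier M"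
  have U: "\<Union> ?C = carrier M"
  proof
    show "\<Union> ?C \<subseteq> carrier M" using cyclic_powers_subset[OF x] by (auto intro: m_closed)
    show "carrier M \<subseteq> \<Union> ?C" using self_in_coset by blast
  qed
  have "elt_order M x * card ?C = card (\<Union> ?C)"
  proof (rule card_partition)
    show "finite ?C" using finite_carrier by simp
    show "finite (\<Union> ?C)" using finite_carrier U by simp
    show "card c = elt_order M x" if "c \<in> ?C" for c using that card_coset[OF x] by auto
    show "c1 \<inter> c2 = {}" if c: "c1 \<in> ?C" "c2 \<in> ?C" "c1 \<noteq> c2" for c1 c2
    proof (rule ccontr)
      assume "c1 \<inter> c2 \<noteq> {}"
      then obtain w where w: "w \<in> c1" "w \<in> c2" by (meson Int_emptyI)
      obtain y1 where "y1 \<in> carrier M" "c1 = (\<otimes>) y1 ` cyclic_powers M x" using c(1) by (elim imageE)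
      then have "(\<otimes>) w ` cyclic_powers M x = c1" using coset_eqI[OF x] w(1) by simp
      moreover obtain y2 where "y2 \<in> carrier M" "c2 = (\<otimes>) y2 ` cyclic_powers M x" using c(2) by (elim imageE)
      then have "(\<otimes>) w ` cyclic_powers M x = c2" using coset_eqI[OF x] w(2) by simp
      ultimately show False using c(3) by simp
    qed
  qed
  then show ?thesis using U by (simp add: order_def)
qed

lemma elt_order_prime_power:
  assumes x: "x \<in> carrier M"
  obtains m where "elt_order M x = p ^ m"
proof -
  obtain k where "order M = p ^ k" using order_power by blast
  then have "elt_order M x dvd p ^ k" using order_eq_mult_cosets[OF x] by (metis dvd_triv_left)
  then show ?thesis using that divides_primepow_nat[OF prime_p] by blast
qed

text \<open>If \<open>x\<close> has order \<open>p^(l+1)\<close>, the exponent \<open>p^l\<close>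
  serves.\<close>

lemma ex_prime_order_power:
  assumes x: "x \<in> carrier M" and "x \<noteq> \<one>"
  obtains n :: nat where "x [^] n \<noteq> \<one>" "(x [^] n) [^] p = \<one>"
proof -
  obtain m where m: "elt_order M x = p ^ m" using elt_order_prime_power[OF x] .
  have "m \<noteq> 0"
  proof
    assume "m = 0"
    then have "x [^] Suc 0 = \<one>" unfolding pow_eq_one_iff[OF x] using m by simp
    then show False using assms pow_Suc_0[OF x] by simp
  qed
  then obtain l where l: "m = Suc l" using not0_implies_Suc by blast
  have "\<not> p ^ m dvd p ^ l" using l p_gt_1 power_dvd_imp_le[of p m l] by auto
  then have "x [^] (p ^ l) \<noteq> \<one>" using m pow_eq_one_iff[OF x] by simp
  moreover have "(x [^] (p ^ l)) [^] p = \<one>"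
    unfolding pow_pow[OF x] pow_eq_one_iff[OF x] using m l by simp
  ultimately show ?thesis using that by blast
qed

text \<open>
  Left multiplication by \<open>x\<close> permutes the cosets \<open>y\<langle>x\<rangle>\<close> and fixes \<open>\<langle>x\<rangle>\<close>; as the number of cosets
  is divisible by \<open>p\<close>, it fixes another one.
\<close>

lemma ex_normalizing:
  assumes x: "x \<in> carrier M" and ne: "carrier M \<noteq> cyclic_powers M x"
  obtains y and i :: nat where "y \<in> carrier M" "y \<notin> cyclic_powers M x" "x \<otimes> y = y \<otimes> x [^] i"
proof -
  let ?cos = "\<lambda>y. (\<otimes>) y ` cyclic_powers M x"
  let ?C = "?cos ` carrier M"
  let ?g = "\<lambda>c. (\<otimes>) x ` c"
  have finC: "finite ?C" using finite_carrier by simp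
  have cos1: "?cos \<one> = cyclic_powers M x"
  proof -
    have "\<one> \<otimes> w = w" if "w \<in> cyclic_powers M x" for w
      using that cyclic_powers_subset[OF x] l_one by blast
    then show ?thesis by simp
  qed
  \<comment> \<open>Flexibility, in the form \<open>x (y x^n) = (x y) x^n\<close>, makes left
    multiplication by \<open>x\<close> act on whole cosets.\<close>
  have g: "?g (?cos y) = ?cos (x \<otimes> y)" if "y \<in> carrier M" for y
    using flexible_pow_right[OF x that] by (auto simp: cyclic_powers_def image_image)
  have gk: "(?g ^^ k) (?cos y) = ?cos (x [^] k \<otimes> y)" if y: "y \<in> carrier M" for k :: nat and y
  proof (induction k)
    case (Suc k)
    have "x \<otimes> (x [^] k \<otimes> y) = x [^] Suc k \<otimes> y"
      using pow_add_left[OF x y, of 1 k] x by (simp add: l_one)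
    then show ?case using Suc g[OF m_closed[OF pow_closed[OF x] y]] by simp
  qed (simp add: y l_one)
  obtain m where m: "elt_order M x = p ^ m" using elt_order_prime_power[OF x] .
  have fixpoints: "[card ?C = card {c \<in> ?C. ?g c = c}] (mod p)"
  proof (rule card_cong_card_fixpoints[OF prime_p finC])
    show "?g ` ?C \<subseteq> ?C" using g x m_closed by auto
    show "(?g ^^ (p ^ m)) c = c" if c: "c \<in> ?C" for c
    proof -
      obtain y where y: "y \<in> carrier M" "c = ?cos y" using c by (elim imageE)
      show ?thesis using gk[OF y(1), of "p ^ m"] y pow_elt_order[OF x] m by (simp add: l_one)
    qed
  qed
  \<comment> \<open>By Lagrange the number of cosets is a power of \<open>p\<close>; it is not 1, as
    a single coset would make \<open>\<langle>x\<rangle>\<close> the whole loop.\<close>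
  have "p dvd card ?C"
  proof -
    obtain k where "order M = p ^ k" using order_power by blast
    then have "card ?C dvd p ^ k" using order_eq_mult_cosets[OF x] by (metis dvd_triv_right)
    then obtain i where i: "card ?C = p ^ i" using divides_primepow_nat[OF prime_p] by blast
    have "i \<noteq> 0"
    proof
      assume "i = 0"
      then have "card (cyclic_powers M x) = card (carrier M)"
        using i order_eq_mult_cosets[OF x] card_cyclic_powers[OF x] by (simp add: order_def)
      then show False using ne card_subset_eq[OF finite_carrier cyclic_powers_subset[OF x]] by simp
    qed
    then show ?thesis using i by (simp add: dvd_power)
  qed
  then have "p dvd card {c \<in> ?C. ?g c = c}" using fixpoints by (simp add: cong_dvd_iff)
  moreover have one: "cyclic_powers M x \<in> {c \<in> ?C. ?g c = c}"
  proof -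
    have "?cos x = ?cos \<one>"
      by (rule coset_eqI[OF x one_closed]) (use cos1 self_in_cyclic_powers[OF x] in simp)
    moreover have "cyclic_powers M x \<in> ?C" using cos1 one_closed by blast
    ultimately show ?thesis using cos1 by simp
  qed
  moreover have "finite {c \<in> ?C. ?g c = c}" using finC by simp
  ultimately have "{c \<in> ?C. ?g c = c} \<noteq> {cyclic_powers M x}" using p_gt_1 by auto
  then obtain c where c: "c \<in> ?C" "?g c = c" "c \<noteq> cyclic_powers M x" using one by blast
  then obtain y where y: "y \<in> carrier M" "c = ?cos y" by (elim imageE)
  have "x \<otimes> y \<in> ?cos y"
    using self_in_coset[OF m_closed[OF x y(1)], of x] g[OF y(1)] c(2) y(2) by simp
  then obtain i :: nat where "x \<otimes> y = y \<otimes> x [^] i" by (auto simp: cyclic_powers_def)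
  moreover have "y \<notin> cyclic_powers M x"
    using coset_eqI[OF x one_closed, of y] cos1 c(3) y(2) by auto
  ultimately show ?thesis using that y(1) by blast
qed

section \<open>Abelian subloops and elements of prime order\<close>

text \<open>The order of \<open>y\<close> is a power of \<open>p\<close>, so some
  \<open>y^(p^m)\<close> lies in \<open>\<langle>x\<rangle>\<close>. For the least such
  \<open>m\<close>, take \<open>w = y^(p^(m-1))\<close>. The set \<open>H\<close> will be either the
  whole loop or an abelian subloop.\<close>

lemma ex_normalizing_pth_power:
  assumes H: "H \<subseteq> carrier M" "\<one> \<in> H" "\<And>v w. \<lbrakk>v \<in> H; w \<in> H\<rbrakk> \<Longrightarrow> v \<otimes> w \<in> H"
    and x: "x \<in> H" and y: "y \<in> H" "y \<notin> cyclic_powers M x"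
    and rel: "x \<otimes> y = y \<otimes> x [^] (i::nat)"
  obtains w and l :: nat where "w \<in> H" "w \<notin> cyclic_powers M x" "w [^] p \<in> cyclic_powers M x"
    "x \<otimes> w = w \<otimes> x [^] (i ^ l)"
proof -
  have xM: "x \<in> carrier M" and yM: "y \<in> carrier M" using H(1) x y by auto
  define m where "m = (LEAST m. y [^] (p ^ m) \<in> cyclic_powers M x)"
  obtain m0 where "elt_order M y = p ^ m0" using elt_order_prime_power[OF yM] .
  then have "y [^] (p ^ m0) \<in> cyclic_powers M x"
    using pow_elt_order[OF yM] one_in_cyclic_powers by simp
  then have m: "y [^] (p ^ m) \<in> cyclic_powers M x" unfolding m_def by (rule LeastI)
  have "m \<noteq> 0"
  proof
    assume "m = 0"
    then have "y [^] Suc 0 \<in> cyclic_powers M x" using m by simp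
    then show False using y(2) pow_Suc_0[OF yM] by simp
  qed
  then obtain l where l: "m = Suc l" using not0_implies_Suc by blast
  show ?thesis
  proof (rule that)
    show "y [^] (p ^ l) \<in> H"
    proof -
      have "y [^] n \<in> H" for n :: nat by (induction n) (simp_all add: H y)
      then show ?thesis .
    qed
    show "y [^] (p ^ l) \<notin> cyclic_powers M x"
      using not_less_Least[of l "\<lambda>m. y [^] (p ^ m) \<in> cyclic_powers M x"] l by (simp add: m_def)
    show "(y [^] (p ^ l)) [^] p \<in> cyclic_powers M x"
      using m l by (simp add: pow_pow[OF yM] mult.commute)
    show "x \<otimes> y [^] (p ^ l) = y [^] (p ^ l) \<otimes> x [^] (i ^ (p ^ l))"
      using pow_swap_pow[OF xM yM rel, of "Suc 0" "p ^ l"] pow_Suc_0[OF xM] by simp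
  qed
qed

text \<open>Otherwise \<open>w^p = x^k\<close> would have the same order as \<open>x\<close>, and
  \<open>w\<close> would have \<open>p\<close> times that order, against \<open>max\<close>.\<close>

lemma pth_power_exponent:
  assumes x: "x \<in> carrier M" and w: "w \<in> carrier M" "w \<notin> cyclic_powers M x"
    and max: "elt_order M w \<le> elt_order M x" and wp: "w [^] p = x [^] (k::nat)"
  shows "p dvd k"
proof (rule ccontr)
  assume "\<not> p dvd k"
  then have "coprime p k" by (rule prime_imp_coprime[OF prime_p])
  obtain N where N: "elt_order M x = p ^ N" using elt_order_prime_power[OF x] .
  obtain l where l: "elt_order M w = p ^ l" using elt_order_prime_power[OF w(1)] .
  have "l \<noteq> 0"
  proof
    assume "l = 0"
    then have "w = \<one>" using l pow_elt_order[OF w(1)] pow_Suc_0[OF w(1)] by simp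
    then show False using w(2) one_in_cyclic_powers by simp
  qed
  then obtain r where r: "l = Suc r" using not0_implies_Suc by blast
  have "x [^] (k * p ^ r) = w [^] (p * p ^ r)"
    using wp pow_pow[OF x, of k "p ^ r"] pow_pow[OF w(1), of p "p ^ r"] by simp
  also have "\<dots> = \<one>" using pow_eq_one_iff[OF w(1)] l r by simp
  finally have "p ^ N dvd k * p ^ r" using pow_eq_one_iff[OF x] N by simp
  then have "p ^ N dvd p ^ r"
    using \<open>coprime p k\<close> by (simp add: coprime_dvd_mult_right_iff)
  then have "N \<le> r" using p_gt_1 power_dvd_imp_le by blast
  moreover have "l \<le> N" using max l N p_gt_1 by simp
  ultimately show False using r by simp
qed

text \<open>The power \<open>w^p\<close> lies in \<open>\<langle>x\<rangle>\<close> and so commutes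
  with \<open>x\<close>, while moving \<open>x\<close> across it turns \<open>x\<close> into
  \<open>x^(i^p)\<close>. Hence \<open>i^p\<close> is 1 modulo the order of \<open>x\<close>, thus
  modulo \<open>p\<close>, and Fermat's little theorem replaces \<open>i^p\<close> by
  \<open>i\<close>.\<close>

lemma action_cong_one:
  assumes x: "x \<in> carrier M" "x \<noteq> \<one>" and w: "w \<in> carrier M"
    and rel: "x \<otimes> w = w \<otimes> x [^] (i::nat)" and wp: "w [^] p \<in> cyclic_powers M x"
  shows "[i = 1] (mod p)"
proof -
  obtain k :: nat where k: "w [^] p = x [^] k" using wp by (auto simp: cyclic_powers_def)
  have pd: "p dvd elt_order M x"
  proof -
    obtain N where N: "elt_order M x = p ^ N" using elt_order_prime_power[OF x(1)] .
    have "N \<noteq> 0"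
    proof
      assume "N = 0"
      then show False using x N pow_elt_order[OF x(1)] pow_Suc_0[OF x(1)] by simp
    qed
    then show ?thesis using N by (simp add: dvd_power)
  qed
  have "x [^] Suc 0 \<otimes> w [^] p = w [^] p \<otimes> x [^] (i ^ p * Suc 0)"
    by (rule pow_swap_pow[OF x(1) w rel])
  then have "x [^] (Suc 0 + k) = x [^] (k + i ^ p)"
    unfolding k pow_mult_pow[OF x(1)] by simp
  then have "[Suc 0 + k = k + i ^ p] (mod elt_order M x)" by (simp only: pow_eq_pow_iff[OF x(1)])
  then have "[k + 1 = k + i ^ p] (mod elt_order M x)"
    by (simp only: One_nat_def add.commute[of "Suc 0"])
  then have "[1 = i ^ p] (mod elt_order M x)" by (simp only: cong_add_lcancel_nat)
  then have ip: "[1 = i ^ p] (mod p)" using pd by (rule cong_dvd_modulus_nat)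
  have "\<not> p dvd i"
  proof
    assume "p dvd i"
    then have "p dvd i ^ p" using p_gt_1 by (simp add: dvd_power_iff_le prime_dvd_power_iff prime_p)
    then have "p dvd 1" using ip cong_dvd_iff by blast
    then show False using p_gt_1 by simp
  qed
  then have "[i ^ (p - 1) = 1] (mod p)" using prime_p fermat_theorem by blast
  then have "[i * i ^ (p - 1) = i * 1] (mod p)" by (intro cong_mult cong_refl)
  moreover have "i * i ^ (p - 1) = i ^ p" using p_gt_1 by (cases p) simp_all
  ultimately show ?thesis using ip cong_trans cong_sym by (metis mult.right_neutral)
qed

text \<open>
  For \<open>w\<close> normalizing \<open>\<langle>x\<rangle>\<close> with \<open>w\<^sup>p = x\<^sup>p\<^sup>j\<close>, one has
  \<open>(w x\<^sup>e)\<^sup>p = x\<^sup>p\<^sup>j \<cdot> x\<^sup>e\<^sup>S\<close> with \<open>S = 1 + i + \<dots> + i\<^sup>p\<^sup>-\<^sup>1\<close>. Since \<open>S\<close> is \<open>p\<close> times a unit,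
  \<open>e\<close> can be chosen to make this trivial. Only this step needs \<open>p\<close> odd or \<open>i = 1\<close>.
\<close>

lemma ex_commuting_prime_order:
  assumes H: "H \<subseteq> carrier M" "\<one> \<in> H" "\<And>v w. \<lbrakk>v \<in> H; w \<in> H\<rbrakk> \<Longrightarrow> v \<otimes> w \<in> H"
    and x: "x \<in> H" and max: "\<And>w. w \<in> H \<Longrightarrow> elt_order M w \<le> elt_order M x"
    and y: "y \<in> H" "y \<notin> cyclic_powers M x"
    and rel: "x \<otimes> y = y \<otimes> x [^] (i::nat)" and odd: "p \<noteq> 2 \<or> i = 1"
  obtains u z where "u \<in> H" "u \<notin> cyclic_powers M x" "u [^] p = \<one>"
    "z \<in> cyclic_powers M x" "z \<noteq> \<one>" "z [^] p = \<one>" "u \<otimes> z = z \<otimes> u"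
proof -
  have xM: "x \<in> carrier M" and yM: "y \<in> carrier M" using H(1) x y by auto
  \<comment> \<open>If \<open>x\<close> were the identity, maximality would make every element of
    \<open>H\<close> trivial, including \<open>y\<close>.\<close>
  have x1: "x \<noteq> \<one>"
  proof
    assume "x = \<one>"
    then have "elt_order M x \<le> Suc 0" using elt_order_le[OF xM, of "Suc 0"] pow_Suc_0[OF xM] by simp
    then have "elt_order M y = Suc 0" using max[OF y(1)] elt_order_pos[OF yM] by simp
    then have "y = \<one>" using pow_elt_order[OF yM] pow_Suc_0[OF yM] by simp
    then show False using y(2) one_in_cyclic_powers by simp
  qed
  obtain w l where w: "w \<in> H" "w \<notin> cyclic_powers M x" "w [^] p \<in> cyclic_powers M x"
    and relw: "x \<otimes> w = w \<otimes> x [^] (i ^ l)"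
    using ex_normalizing_pth_power[OF H x y rel] by blast
  have wM: "w \<in> carrier M" using w H(1) by auto
  define r where "r = i ^ l"
  have rel': "x \<otimes> w = w \<otimes> x [^] r" using relw by (simp add: r_def)
  have r1: "[r = 1] (mod p)" by (rule action_cong_one[OF xM x1 wM rel' w(3)])
  have "p \<noteq> 2 \<or> r = 1" using odd by (auto simp: r_def)
  then obtain q where q: "(\<Sum>t<p. r ^ t) = p * q" "coprime q p"
    using geometric_sum_prime[OF prime_p r1] by blast
  obtain k :: nat where k: "w [^] p = x [^] k" using w(3) by (auto simp: cyclic_powers_def)
  have "p dvd k" by (rule pth_power_exponent[OF xM wM w(2) max[OF w(1)] k])
  then obtain j where j: "k = p * j" by (elim dvdE)
  let ?o = "elt_order M x"
  obtain N where N: "?o = p ^ N" using elt_order_prime_power[OF xM] .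
  have "N \<noteq> 0"
  proof
    assume "N = 0"
    then show False using x1 N pow_elt_order[OF xM] pow_Suc_0[OF xM] by simp
  qed
  then obtain n where n: "N = Suc n" using not0_implies_Suc by blast
  have "coprime q ?o" using q(2) N by simp
  then obtain e0 where e0: "[q * e0 = Suc 0] (mod ?o)" using cong_solve_coprime_nat by blast
  \<comment> \<open>Modulo the order of \<open>x\<close>, \<open>e0\<close> inverts \<open>q\<close>
    and \<open>?o - 1\<close> is \<open>-1\<close>. So \<open>e\<close> represents
    \<open>-j / q\<close>, the solution of \<open>j + q * e\<close> \<equiv> 0.\<close>
  define e where "e = e0 * (j * (?o - 1))"
  have "[j + q * e0 * (j * (?o - 1)) = j + Suc 0 * (j * (?o - 1))] (mod ?o)"
    by (intro cong_add cong_mult cong_refl e0)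
  also have "j + Suc 0 * (j * (?o - 1)) = j * ?o" using elt_order_pos[OF xM] by (cases ?o) simp_all
  finally have "[j + q * e = j * ?o] (mod ?o)" by (simp only: e_def mult.assoc)
  then have oe: "?o dvd j + q * e" using cong_dvd_iff by (metis dvd_triv_right)
  define u where "u = w \<otimes> x [^] e"
  \<comment> \<open>As \<open>x\<close> has order \<open>p ^ Suc n\<close>, this element of
    \<open>\<langle>x\<rangle>\<close> has order \<open>p\<close>.\<close>
  define z where "z = x [^] (p ^ n)"
  have powH: "x [^] m \<in> H" for m :: nat by (induction m) (simp_all add: H x)
  show ?thesis
  proof (rule that)
    show "u \<in> H" unfolding u_def using H(3)[OF w(1) powH] .
    show "u \<notin> cyclic_powers M x"
    proof
      assume "u \<in> cyclic_powers M x"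
      then obtain a :: nat where a: "w \<otimes> x [^] e = x [^] a" by (auto simp: cyclic_powers_def u_def)
      have "w = x [^] a \<otimes> x [^] (e * (?o - 1))" using coset_undo[OF xM wM, of e] a by simp
      also have "\<dots> \<in> cyclic_powers M x" unfolding pow_mult_pow[OF xM] by (rule pow_in_cyclic_powers)
      finally show False using w(2) by simp
    qed
    have "u [^] p = w [^] p \<otimes> x [^] (e * (p * q))"
      unfolding u_def q(1)[symmetric] by (rule metacyclic_pow[OF xM wM rel'])
    also have "\<dots> = x [^] (p * (j + q * e))"
      unfolding k j pow_mult_pow[OF xM] by (simp add: algebra_simps)
    also have "\<dots> = \<one>" unfolding pow_eq_one_iff[OF xM] using oe by simp
    finally show "u [^] p = \<one>" .
    show "z \<in> cyclic_powers M x" unfolding z_def by (rule pow_in_cyclic_powers)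
    show "z \<noteq> \<one>"
      unfolding z_def pow_eq_one_iff[OF xM] N n using p_gt_1 power_dvd_imp_le[of p "Suc n" n] by auto
    show "z [^] p = \<one>" unfolding z_def pow_pow[OF xM] pow_eq_one_iff[OF xM] N n by simp
    have "u \<otimes> z = (w [^] Suc 0 \<otimes> x [^] e) \<otimes> (w [^] (0::nat) \<otimes> x [^] (p ^ n))"
      by (simp add: u_def z_def pow_Suc_0[OF wM] l_one pow_closed[OF xM] wM)
    also have "\<dots> = w [^] Suc 0 \<otimes> x [^] (e + p ^ n)"
      unfolding metacyclic_mult[OF xM wM rel'] by simp
    also have "x [^] (e + p ^ n) = x [^] (r * p ^ n + e)"
    proof -
      \<comment> \<open>Since \<open>r\<close> is 1 modulo \<open>p\<close>,
        \<open>r * p ^ n\<close> and \<open>p ^ n\<close> agree modulo the order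
        \<open>p ^ Suc n\<close> of \<open>x\<close>: conjugation by \<open>w\<close> fixes
        \<open>z\<close>.\<close>
      have "[p ^ n * r = p ^ n * 1] (mod p ^ n * p)"
        using r1 by (simp only: cong_def mult_mod_right[symmetric])
      then have "[e + r * p ^ n = e + p ^ n] (mod ?o)"
        unfolding N n by (intro cong_add cong_refl) (simp add: mult.commute)
      then have "[e + p ^ n = r * p ^ n + e] (mod ?o)" by (simp add: add.commute cong_sym)
      then show ?thesis using pow_eq_pow_iff[OF xM] by simp
    qed
    also have "w [^] Suc 0 \<otimes> x [^] (r * p ^ n + e)
      = (w [^] (0::nat) \<otimes> x [^] (p ^ n)) \<otimes> (w [^] Suc 0 \<otimes> x [^] e)"
      unfolding metacyclic_mult[OF xM wM rel'] by simp
    also have "\<dots> = z \<otimes> u"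
      by (simp add: u_def z_def pow_Suc_0[OF wM] l_one pow_closed[OF xM] wM)
    finally show "u \<otimes> z = z \<otimes> u" .
  qed
qed

section \<open>Subloops generated by two commuting elements\<close>

lemma commuting_products_mult:
  assumes u: "u \<in> carrier M" and z: "z \<in> carrier M" and comm: "u \<otimes> z = z \<otimes> u"
  shows "(u [^] (a::nat) \<otimes> z [^] (b::nat)) \<otimes> (u [^] (c::nat) \<otimes> z [^] (d::nat))
    = u [^] (a + c) \<otimes> z [^] (b + d)"
proof -
  have "z \<otimes> u = u \<otimes> z [^] Suc 0" using comm pow_Suc_0[OF z] by simp
  from metacyclic_mult[OF z u this] show ?thesis by simp
qed

text \<open>The products \<open>u^a z^b\<close> multiply by adding exponents, so closure,
  associativity and commutativity come from addition.\<close>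

lemma abelian_subloop_commuting:
  assumes u: "u \<in> carrier M" and z: "z \<in> carrier M" and comm: "u \<otimes> z = z \<otimes> u"
  shows "abelian_subloop {u [^] (a::nat) \<otimes> z [^] (b::nat) | a b. True} M"
    (is "abelian_subloop ?A M")
proof -
  note mult = commuting_products_mult[OF u z comm]
  have sub: "?A \<subseteq> carrier M" using u z by (auto intro!: m_closed pow_closed)
  have "subloop ?A M"
  proof (rule subloop_of_finite_closed[OF _ sub])
    show "finite ?A" using finite_carrier sub finite_subset by blast
    have "\<one> = u [^] (0::nat) \<otimes> z [^] (0::nat)" by (simp add: l_one one_closed)
    then show "\<one> \<in> ?A" by blast
    show "v \<otimes> w \<in> ?A" if vw: "v \<in> ?A" "w \<in> ?A" for v w
    proof -
      obtain a b c d :: nat where "v = u [^] a \<otimes> z [^] b" "w = u [^] c \<otimes> z [^] d"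
        using vw by blast
      then have "v \<otimes> w = u [^] (a + c) \<otimes> z [^] (b + d)" by (simp only: mult)
      then show ?thesis by blast
    qed
  qed
  moreover have "associative (M\<lparr>carrier := ?A\<rparr>)"
    by (auto simp: associative_def mult add.assoc)
  moreover have "commutative (M\<lparr>carrier := ?A\<rparr>)"
    by (auto simp: commutative_def mult add.commute)
  ultimately show ?thesis by (simp add: abelian_subloop_def)
qed

lemma nat_pow_carrier_update: "x [^]\<^bsub>M\<lparr>carrier := H\<rparr>\<^esub> (n::nat) = x [^] n"
  by (simp add: nat_pow_def)

text \<open>Exponents of a generator can be reduced modulo \<open>p\<close>. They are integers in
  \<open>G.cyclic_group\<close>, hence the representative \<open>nat (n mod int p)\<close>.\<close>

lemma card_cyclic_exponent_p:
  assumes H: "abelian_subloop H M" and cyc: "cyclic_group (M\<lparr>carrier := H\<rparr>)"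
    and expo: "\<And>w. w \<in> H \<Longrightarrow> w [^] p = \<one>"
  shows "card H \<le> p"
proof -
  let ?G = "M\<lparr>carrier := H\<rparr>"
  interpret G: comm_group ?G using H by (rule abelian_subloop_imp_comm_group)
  obtain g where g: "g \<in> carrier ?G" and rng: "carrier ?G = range (\<lambda>n::int. g [^]\<^bsub>?G\<^esub> n)"
    using cyc unfolding G.cyclic_group by blast
  have gp: "g [^]\<^bsub>?G\<^esub> int p = \<one>\<^bsub>?G\<^esub>"
    using expo[of g] g by (simp add: int_pow_int nat_pow_carrier_update)
  have "H \<subseteq> (\<lambda>n. g [^]\<^bsub>?G\<^esub> int n) ` {..<p}"
  proof
    fix w assume "w \<in> H"
    then obtain n :: int where n: "w = g [^]\<^bsub>?G\<^esub> n" using rng by auto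
    have "w = g [^]\<^bsub>?G\<^esub> (int p * (n div int p) + n mod int p)" using n by simp
    also have "\<dots> = (g [^]\<^bsub>?G\<^esub> int p) [^]\<^bsub>?G\<^esub> (n div int p) \<otimes>\<^bsub>?G\<^esub> g [^]\<^bsub>?G\<^esub> (n mod int p)"
      unfolding G.int_pow_pow[OF g] by (rule G.int_pow_mult[OF g])
    also have "\<dots> = g [^]\<^bsub>?G\<^esub> (n mod int p)"
      unfolding gp G.int_pow_one by (rule G.l_one[OF G.int_pow_closed[OF g]])
    also have "n mod int p = int (nat (n mod int p))" using p_gt_1 by simp
    finally have "w = g [^]\<^bsub>?G\<^esub> int (nat (n mod int p))" .
    moreover have "nat (n mod int p) < p" using p_gt_1 by (simp add: nat_less_iff)
    ultimately show "w \<in> (\<lambda>n. g [^]\<^bsub>?G\<^esub> int n) ` {..<p}" by blast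
  qed
  then have "card H \<le> card {..<p}" using surj_card_le[of "{..<p}" H] by simp
  then show ?thesis by simp
qed

text \<open>Translates from the natural powers of \<open>cyclic_powers\<close> to the integer powers
  of \<open>cyclic_group\<close>.\<close>

lemma cyclic_group_of_subset_cyclic_powers:
  assumes H: "abelian_subloop H M" and x: "x \<in> H" and sub: "H \<subseteq> cyclic_powers M x"
  shows "cyclic_group (M\<lparr>carrier := H\<rparr>)"
proof -
  let ?G = "M\<lparr>carrier := H\<rparr>"
  interpret G: comm_group ?G using H by (rule abelian_subloop_imp_comm_group)
  have "H \<subseteq> range (\<lambda>n::int. x [^]\<^bsub>?G\<^esub> n)"
  proof
    fix w assume "w \<in> H"
    then obtain n :: nat where "w = x [^] n" using sub by (auto simp: cyclic_powers_def)
    then have "w = x [^]\<^bsub>?G\<^esub> int n" by (simp add: int_pow_int nat_pow_carrier_update)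
    then show "w \<in> range (\<lambda>n::int. x [^]\<^bsub>?G\<^esub> n)" by blast
  qed
  moreover have "range (\<lambda>n::int. x [^]\<^bsub>?G\<^esub> n) \<subseteq> H" using G.int_pow_closed x by auto
  ultimately show ?thesis unfolding G.cyclic_group using x by (intro bexI[of _ x]) auto
qed

text \<open>The abelian subloop generated by \<open>u\<close> and \<open>z\<close> satisfies
  \<open>w^p = \<one>\<close>; being cyclic, it has at most \<open>p\<close> elements. The powers of
  \<open>z\<close> already number \<open>p\<close>, so they fill it.\<close>

lemma commuting_prime_order_powers:
  assumes cyc: "\<And>H. abelian_subloop H M \<Longrightarrow> cyclic_group (M\<lparr>carrier := H\<rparr>)"
    and u: "u \<in> carrier M" "u [^] p = \<one>" and z: "z \<in> carrier M" "z [^] p = \<one>" "z \<noteq> \<one>"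
    and comm: "u \<otimes> z = z \<otimes> u"
  shows "u \<in> cyclic_powers M z"
proof -
  let ?A = "{u [^] (a::nat) \<otimes> z [^] (b::nat) | a b. True}"
  have A: "abelian_subloop ?A M" by (rule abelian_subloop_commuting[OF u(1) z(1) comm])
  have pow: "(u [^] a \<otimes> z [^] b) [^] n = u [^] (a * n) \<otimes> z [^] (b * n)" for a b n :: nat
    by (induction n)
      (simp_all add: commuting_products_mult[OF u(1) z(1) comm] l_one one_closed add.commute)
  have up: "u [^] (a * p) = \<one>" and zp: "z [^] (a * p) = \<one>" for a :: nat
    using u(2) z(2) pow_eq_one_iff[OF u(1)] pow_eq_one_iff[OF z(1)] by (simp_all add: dvd_mult)
  have "w [^] p = \<one>" if "w \<in> ?A" for w using that by (auto simp: pow up zp l_one one_closed)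
  then have cardA: "card ?A \<le> p" using card_cyclic_exponent_p[OF A cyc[OF A]] by blast
  have sub: "cyclic_powers M z \<subseteq> ?A"
  proof
    fix w assume "w \<in> cyclic_powers M z"
    then obtain n :: nat where "w = z [^] n" by (auto simp: cyclic_powers_def)
    then have "w = u [^] (0::nat) \<otimes> z [^] n" using z(1) by (simp add: l_one pow_closed)
    then show "w \<in> ?A" by blast
  qed
  have "card (cyclic_powers M z) = p"
    using card_cyclic_powers[OF z(1)] elt_order_eq_prime_iff[OF z(1)] z by simp
  moreover have "finite ?A"
    using finite_carrier A finite_subset by (auto simp: abelian_subloop_def subloop_def)
  ultimately have "cyclic_powers M z = ?A" using card_seteq[OF _ sub] cardA by simp
  moreover have "u = u [^] Suc 0 \<otimes> z [^] (0::nat)"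
    using pow_Suc_0[OF u(1)] u(1) by (simp add: r_one)
  then have "u \<in> ?A" by blast
  ultimately show ?thesis by simp
qed

section \<open>The two directions of the equivalence\<close>

text \<open>Such a loop is even cyclic. If \<open>x\<close> of maximal order did not generate it,
  there would be commuting \<open>u\<close> outside and \<open>z\<close> inside
  \<open>\<langle>x\<rangle>\<close> with trivial \<open>p\<close>-th powers and \<open>z\<close>
  nontrivial; then \<open>u\<close> would be a power of \<open>z\<close>.\<close>

lemma associative_if_odd:
  assumes cyc: "\<And>H. abelian_subloop H M \<Longrightarrow> cyclic_group (M\<lparr>carrier := H\<rparr>)" and odd: "p \<noteq> 2"
  shows "associative M"
proof -
  have "finite (elt_order M ` carrier M)" "elt_order M ` carrier M \<noteq> {}"
    using finite_carrier one_closed by auto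
  then obtain x where x: "x \<in> carrier M" "elt_order M x = Max (elt_order M ` carrier M)"
    using Max_in by (metis imageE)
  then have max: "elt_order M w \<le> elt_order M x" if "w \<in> carrier M" for w
    using that finite_carrier by simp
  have "carrier M = cyclic_powers M x"
  proof (rule ccontr)
    assume "carrier M \<noteq> cyclic_powers M x"
    then obtain y i where y: "y \<in> carrier M" "y \<notin> cyclic_powers M x" "x \<otimes> y = y \<otimes> x [^] (i::nat)"
      using ex_normalizing[OF x(1)] by blast
    obtain u z where uz: "u \<in> carrier M" "u \<notin> cyclic_powers M x" "u [^] p = \<one>"
      "z \<in> cyclic_powers M x" "z \<noteq> \<one>" "z [^] p = \<one>" "u \<otimes> z = z \<otimes> u"
      using ex_commuting_prime_order[OF subset_refl one_closed m_closed x(1) max y] odd by blast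
    have "z \<in> carrier M" using uz(4) cyclic_powers_subset[OF x(1)] by blast
    then have "u \<in> cyclic_powers M z"
      using commuting_prime_order_powers[OF cyc] uz by blast
    then show False using uz(2) cyclic_powers_mono[OF x(1) uz(4)] by blast
  qed
  then show ?thesis
    by (auto simp: associative_def cyclic_powers_def pow_mult_pow[OF x(1)] add.assoc)
qed

text \<open>The relation says that \<open>w\<close> inverts \<open>x\<close> under conjugation. The
  innermost \<open>x (w x)\<close> collapses to \<open>w\<close>, one pair of factors at a
  time.\<close>

lemma pow_sandwich:
  assumes x: "x \<in> carrier M" and w: "w \<in> carrier M" and rel: "x \<otimes> (w \<otimes> x) = w"
  shows "x [^] (n::nat) \<otimes> (w \<otimes> x [^] n) = w"
proof (induction n)
  case (Suc n)
  have "w \<otimes> x [^] Suc n = (w \<otimes> x) \<otimes> x [^] n"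
    using pow_add_right[OF x w, of "Suc 0" n] pow_Suc_0[OF x] by simp
  then have "x [^] Suc n \<otimes> (w \<otimes> x [^] Suc n) = x [^] n \<otimes> (x \<otimes> ((w \<otimes> x) \<otimes> x [^] n))"
    using pow_add_left[OF x, of "(w \<otimes> x) \<otimes> x [^] n" n "Suc 0"] pow_Suc_0[OF x] x w
    by (simp add: m_closed pow_closed)
  also have "x \<otimes> ((w \<otimes> x) \<otimes> x [^] n) = (x \<otimes> (w \<otimes> x)) \<otimes> x [^] n"
    by (rule flexible_pow_right[OF x m_closed[OF w x]])
  finally show ?case using rel Suc by simp
qed (simp add: w l_one r_one)

text \<open>
  For involutions \<open>a\<close> and \<open>b\<close> with product \<open>x\<close>, both satisfy \<open>x w x = w\<close>. Hence both commute with
  the involution in \<open>\<langle>x\<rangle>\<close> and must equal it.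
\<close>

lemma involutions_unique:
  assumes cyc: "\<And>H. abelian_subloop H M \<Longrightarrow> cyclic_group (M\<lparr>carrier := H\<rparr>)" and p2: "p = 2"
    and a: "a \<in> carrier M" "a \<noteq> \<one>" "a [^] p = \<one>" and b: "b \<in> carrier M" "b \<noteq> \<one>" "b [^] p = \<one>"
  shows "a = b"
proof (rule ccontr)
  assume ne: "a \<noteq> b"
  have sq: "w [^] p = w \<otimes> w" if "w \<in> carrier M" for w
    using that by (simp add: p2 numeral_2_eq_2 l_one)
  have aa: "a \<otimes> a = \<one>" and bb: "b \<otimes> b = \<one>" using sq a b by auto
  let ?x = "a \<otimes> b"
  have xM: "?x \<in> carrier M" by (rule m_closed[OF a(1) b(1)])
  have x1: "?x \<noteq> \<one>"
    using l_cancel[OF a(1) b(1) a(1)] aa ne by auto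
  \<comment> \<open>As \<open>a\<close> and \<open>b\<close> are their own inverses, the inverse
    properties give \<open>a (a b) = b\<close> and \<open>(a b) b = a\<close>, from which both
    sandwich relations follow.\<close>
  have ax: "a \<otimes> ?x = b"
    using left_inverse_property[OF a(1) b(1)] linv_unique[OF a(1) a(1) aa] by simp
  have xb: "?x \<otimes> b = a"
    using right_inverse_property[OF a(1) b(1)] linv_unique[OF b(1) b(1) bb] by simp
  have rela: "?x \<otimes> (a \<otimes> ?x) = a" using ax xb by simp
  have relb: "?x \<otimes> (b \<otimes> ?x) = b" using flexible[OF b(1) xM] xb ax by simp
  obtain n :: nat where n: "?x [^] n \<noteq> \<one>" "(?x [^] n) [^] p = \<one>"
    using ex_prime_order_power[OF xM x1] .
  define c where "c = ?x [^] n"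
  have c: "c \<in> carrier M" "c \<noteq> \<one>" "c [^] p = \<one>" using n pow_closed[OF xM] by (simp_all add: c_def)
  have cc: "c \<otimes> c = \<one>" using sq c by auto
  have eq_c: "w = c" if w: "w \<in> carrier M" "w \<noteq> \<one>" "w [^] p = \<one>" and rel: "?x \<otimes> (w \<otimes> ?x) = w" for w
  proof -
    \<comment> \<open>The sandwich relation passes from the product to its power \<open>c\<close>;
      since \<open>c\<close> is its own inverse, it then means commutation.\<close>
    have "c \<otimes> (w \<otimes> c) = w" unfolding c_def by (rule pow_sandwich[OF xM w(1) rel])
    then have "c \<otimes> w = w \<otimes> c"
      using left_inverse_property[OF c(1) m_closed[OF w(1) c(1)]] linv_unique[OF c(1) c(1) cc] by simp
    then have "w \<in> cyclic_powers M c"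
      using commuting_prime_order_powers[OF cyc w(1,3) c(1,3,2)] by simp
    then obtain k :: nat where "w = c [^] k" by (auto simp: cyclic_powers_def)
    moreover have "c [^] k = \<one> \<or> c [^] k = c" for k :: nat
      by (induction k) (auto simp: cc l_one c)
    ultimately show ?thesis using w(2) by auto
  qed
  show False using eq_c[OF a rela] eq_c[OF b relb] ne by simp
qed

text \<open>In \<open>H\<close> everything commutes, so \<open>ex_commuting_prime_order\<close>
  applies with \<open>i = 1\<close>. If \<open>H\<close> exceeded \<open>\<langle>x\<rangle>\<close>
  for \<open>x\<close> of maximal order in \<open>H\<close>, there would be two elements of order
  \<open>p\<close>, one outside \<open>\<langle>x\<rangle>\<close> and one inside.\<close>

lemma cyclic_abelian_subloops_if_unique:
  assumes ex1: "\<exists>!x. x \<in> carrier M \<and> elt_order M x = p" and H: "abelian_subloop H M"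
  shows "cyclic_group (M\<lparr>carrier := H\<rparr>)"
proof -
  have HM: "H \<subseteq> carrier M" using H by (simp add: abelian_subloop_def subloop_def)
  interpret L: loop "M\<lparr>carrier := H\<rparr>" using H by (simp add: abelian_subloop_def subloop_def)
  have one: "\<one> \<in> H" using L.one_closed by simp
  have closed: "v \<otimes> w \<in> H" if "v \<in> H" "w \<in> H" for v w using L.m_closed that by simp
  have "finite (elt_order M ` H)" "elt_order M ` H \<noteq> {}"
    using finite_carrier HM finite_subset one by auto
  then obtain x where x: "x \<in> H" "elt_order M x = Max (elt_order M ` H)"
    using Max_in by (metis imageE)
  then have max: "elt_order M w \<le> elt_order M x" if "w \<in> H" for w
    using that \<open>finite (elt_order M ` H)\<close> x(2) by simp
  have xM: "x \<in> carrier M" using x(1) HM by blast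
  have "H \<subseteq> cyclic_powers M x"
  proof
    fix y assume y: "y \<in> H"
    show "y \<in> cyclic_powers M x"
    proof (rule ccontr)
      assume ny: "y \<notin> cyclic_powers M x"
      have "x \<otimes> y = y \<otimes> x"
        using H x(1) y by (auto simp: abelian_subloop_def commutative_def)
      then have rel: "x \<otimes> y = y \<otimes> x [^] (1::nat)" using pow_Suc_0[OF xM] by simp
      obtain u z where uz: "u \<in> H" "u \<notin> cyclic_powers M x" "u [^] p = \<one>"
        "z \<in> cyclic_powers M x" "z \<noteq> \<one>" "z [^] p = \<one>"
        using ex_commuting_prime_order[OF HM one closed x(1) max y ny rel] by blast
      have uM: "u \<in> carrier M" and zM: "z \<in> carrier M"
        using uz(1,4) HM cyclic_powers_subset[OF xM] by auto
      have "u \<noteq> \<one>" using uz(2) one_in_cyclic_powers by auto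
      then have "elt_order M u = p" "elt_order M z = p"
        using elt_order_eq_prime_iff[OF uM] elt_order_eq_prime_iff[OF zM] uz by auto
      then have "u = z" using ex1 uM zM by blast
      then show False using uz by simp
    qed
  qed
  then show ?thesis by (rule cyclic_group_of_subset_cyclic_powers[OF H x(1)])
qed

text \<open>Nonassociativity forces \<open>p = 2\<close>, where \<open>involutions_unique\<close>
  gives uniqueness. A suitable power of any nonidentity element gives existence.\<close>

lemma ex1_elt_order_p:
  assumes cyc: "\<And>H. abelian_subloop H M \<Longrightarrow> cyclic_group (M\<lparr>carrier := H\<rparr>)"
    and na: "\<not> associative M"
  shows "\<exists>!x. x \<in> carrier M \<and> elt_order M x = p"
proof -
  have p2: "p = 2" using associative_if_odd[OF cyc] na by blast
  have "carrier M \<noteq> {\<one>}"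
    using na by (auto simp: associative_def l_one one_closed)
  then obtain x where x: "x \<in> carrier M" "x \<noteq> \<one>" using one_closed by blast
  obtain n :: nat where n: "x [^] n \<noteq> \<one>" "(x [^] n) [^] p = \<one>"
    using ex_prime_order_power[OF x] .
  show ?thesis
  proof (rule ex1I[of _ "x [^] n"])
    have "x [^] n \<in> carrier M" by (rule pow_closed[OF x(1)])
    then show xn: "x [^] n \<in> carrier M \<and> elt_order M (x [^] n) = p"
      using n elt_order_eq_prime_iff by simp
    show "y = x [^] n" if "y \<in> carrier M \<and> elt_order M y = p" for y
      using involutions_unique[OF cyc p2] that xn elt_order_eq_prime_iff by blast
  qed
qed

end

theorem theorem1p3:
  fixes M :: "('a, 'm) monoid_scheme"
  assumes "moufang_loop M" and "finite (carrier M)"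
  shows "generalized_octonion_loop M \<longleftrightarrow>
    \<not> associative M \<and>
    (\<exists>p::nat. Factorial_Ring.prime p \<and> (\<exists>k. order M = p ^ k) \<and>
       (\<exists>!x. x \<in> carrier M \<and> elt_order M x = p))"
proof
  assume g: "generalized_octonion_loop M"
  then obtain p where "moufang_p_loop M p" by (auto simp: generalized_octonion_loop_def)
  then interpret moufang_p_loop M p .
  have "\<not> associative M" and "\<And>H. abelian_subloop H M \<Longrightarrow> cyclic_group (M\<lparr>carrier := H\<rparr>)"
    using g by (auto simp: generalized_octonion_loop_def)
  then show "\<not> associative M \<and> (\<exists>p::nat. Factorial_Ring.prime p \<and> (\<exists>k. order M = p ^ k) \<and>
       (\<exists>!x. x \<in> carrier M \<and> elt_order M x = p))"
    using prime_p order_power ex1_elt_order_p by blast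
next
  assume "\<not> associative M \<and> (\<exists>p::nat. Factorial_Ring.prime p \<and> (\<exists>k. order M = p ^ k) \<and>
       (\<exists>!x. x \<in> carrier M \<and> elt_order M x = p))"
  then obtain p :: nat where na: "\<not> associative M" and p: "Factorial_Ring.prime p"
    and k: "\<exists>k. order M = p ^ k" and ex1: "\<exists>!x. x \<in> carrier M \<and> elt_order M x = p" by blast
  have "moufang_p_loop M p"
    using assms p k by (simp add: moufang_p_loop_def moufang_p_loop_axioms_def)
  then interpret moufang_p_loop M p .
  show "generalized_octonion_loop M"
    unfolding generalized_octonion_loop_def
    using na \<open>moufang_p_loop M p\<close> cyclic_abelian_subloops_if_unique[OF ex1] by blast
qed

end
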